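(* Let $(G,G')$ be one of the three dual pairs described in the context (in the stable range). Let $\mathbb{O}'\subset\mathfrak{s}'$ be a nilpotent $K'_{\mathbb{C}}$-orbit and $\mathbb{O}=\theta(\mathbb{O}')$ its theta lift. If $\mathbb{O}'$ corresponds to a signed Young diagram $\lambda'$, then $\mathbb{O}$ corresponds to the signed Young diagram $\lambda$ obtained by adding one box to the right end of each row (including empty rows) of $\lambda'$. The signs of the added boxes (and the number of empty rows to which a box is added) are completely determined by the requirement that $\lambda$ is a signed Young diagram for $(G,K)$.
   Context: Everything is over $\mathbb{C}$. $M_{a,b}$ is the space of complex $a\times b$ matrices, $\mathrm{Sym}_n$, $\mathrm{Alt}_n$ the symmetric and alternating $n\times n$ matrices, ${}^tA$ the transpose, ${}^tg^{-1}=({}^tg)^{-1}$. All parameters $p,q,m,n$ are positive integers. $(G,G')$ is one of the following pairs; $K$ is a maximal compact subgroup of $G$; $K_{\mathbb{C}}$, $K'_{\mathbb{C}}$ are complexified maximal compact subgroups of $G,G'$; $W=W^+\oplus W^-$, $\mathfrak{s}$ and $\mathfrak{s}'=\mathfrak{s}'_+\oplus\mathfrak{s}'_-$ are the vector spaces below; $\varphi:W\to\mathfrak{s}$ and $\psi:W\to\mathfrak{s}'$ are the moment maps. Case 1: $G=O(p,q)$, $G'=Sp(2n,\mathbb{R})$, $2n<\min(p,q)$. $K_{\mathbb{C}}=O(p,\mathbb{C})\times O(q,\mathbb{C})$, $K'_{\mathbb{C}}=GL_n(\mathbb{C})$; $W^+=M_{p,n}\ni A$, $W^-=M_{q,n}\ni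 B$; $\mathfrak{s}=M_{p,q}$, $\mathfrak{s}'_\pm=\mathrm{Sym}_n$. Actions: $(k_1,k_2,g)\cdot(A,B)=(k_1A\,{}^tg,\;k_2Bg^{-1})$; $(k_1,k_2)\cdot Z=k_1Zk_2^{-1}$ on $\mathfrak{s}$; $g\cdot(X,Y)=(gX\,{}^tg,\;{}^tg^{-1}Yg^{-1})$ on $\mathfrak{s}'$. $\varphi(A,B)=A\,{}^tB$, $\psi(A,B)=({}^tAA,\,{}^tBB)$. Case 2: $G=U(p,q)$, $G'=U(m,n)$, $m+n\le\min(p,q)$. $K_{\mathbb{C}}=GL_p(\mathbb{C})\times GL_q(\mathbb{C})$, $K'_{\mathbb{C}}=GL_m(\mathbb{C})\times GL_n(\mathbb{C})$; $W^+=M_{p,m}\oplus M_{p,n}\ni(A,B)$, $W^-=M_{q,m}\oplus M_{q,n}\ni(C,D)$; $\mathfrak{s}=M_{p,q}\oplus M_{q,p}$, $\mathfrak{s}'_+=M_{m,n}$, $\mathfrak{s}'_-=M_{n,m}$. Actions: $((g_1,g_2),(h_1,h_2))\cdot(A,B,C,D)=(g_1A\,{}^th_1,\;{}^tg_1^{-1}Bh_2^{-1},\;{}^tg_2^{-1}Ch_1^{-1},\;g_2D\,{}^th_2)$; $(g_1,g_2)\cdot(Z_1,Z_2)=(g_1Z_1g_2^{-1},g_2Z_2g_1^{-1})$; $(h_1,h_2)\cdot(X,Y)=(h_1Xh_2^{-1},h_2Yh_1^{-1})$. $\varphi(A,B,C,D)=(A\,{}^tC,\,D\,{}^tB)$,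 $\psi(A,B,C,D)=({}^tAB,\,{}^tDC)$. Case 3: $G=Sp(p,q)$, $G'=O^*(2n)$, $n\le\min(p,q)$. With $J_p=\begin{pmatrix}0&1_p\\ -1_p&0\end{pmatrix}$: $K_{\mathbb{C}}=Sp(2p,\mathbb{C})\times Sp(2q,\mathbb{C})$, $K'_{\mathbb{C}}=GL_n(\mathbb{C})$; $W^+=M_{2p,n}\ni A$, $W^-=M_{2q,n}\ni B$; $\mathfrak{s}=M_{2p,2q}$, $\mathfrak{s}'_\pm=\mathrm{Alt}_n$. Actions: $(k_1,k_2,g)\cdot(A,B)=(k_1A\,{}^tg,\;{}^tk_2^{-1}Bg^{-1})$; $(k_1,k_2)\cdot Z=k_1Zk_2^{-1}$; $g\cdot(X,Y)=(gX\,{}^tg,\;{}^tg^{-1}Yg^{-1})$. $\varphi(A,B)=A\,{}^tB$, $\psi(A,B)=({}^tAJ_pA,\,{}^tBJ_qB)$. To $(X,Y)\in\mathfrak{s}'$ associate $x=\begin{pmatrix}0&X\\ Y&0\end{pmatrix}$, acting on $V'=V'_+\oplus V'_-$ with $V'_+$ the first and $V'_-$ the second block ($\mathbb{C}^n\oplus\mathbb{C}^n$ in cases 1, 3; $\mathbb{C}^m\oplus\mathbb{C}^n$ in case 2). To an element of $\mathfrak{s}$ associate $z=\begin{pmatrix}0&Z\\ -{}^tZ&0\end{pmatrix}$ (case 1), $\begin{pmatrix}0&Z_1\\ Z_2&0\end{pmatrix}$ (case 2), $\begin{pmatrix}0&Z\\ J_q{}^tZJ_p&0\end{pmatrix}$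 (case 3), acting on $V=V_+\oplus V_-$ ($\mathbb{C}^p\oplus\mathbb{C}^q$ in cases 1, 2; $\mathbb{C}^{2p}\oplus\mathbb{C}^{2q}$ in case 3). An element is nilpotent iff its associated matrix is; nilpotent orbits consist of nilpotent elements. Theta lift: for a nilpotent $K'_{\mathbb{C}}$-orbit $\mathbb{O}'\subset\mathfrak{s}'$, the set $\varphi(\psi^{-1}(\overline{\mathbb{O}'}))$ is the closure of a single nilpotent $K_{\mathbb{C}}$-orbit $\mathbb{O}\subset\mathfrak{s}$; one writes $\mathbb{O}=\theta(\mathbb{O}')$. Signed Young diagrams: a signed Young diagram is a Young diagram whose boxes carry signs $\pm$ alternating along each row, considered up to permuting rows of equal length; its signature $(a,b)$ is (number of $+$, number of $-$). Nilpotent $K_{\mathbb{C}}$-orbits (resp. $K'_{\mathbb{C}}$-orbits) are classified by the following signed Young diagrams: $Sp(2n,\mathbb{R})$: size $2n$, any signature, odd rows begin with $+$ and occur with even multiplicity; $O(p,q)$: size $p+q$, signature $(p,q)$, even rows begin with $+$ and occur with even multiplicity; $U(m,n)$: size $m+n$, signature $(m,n)$ (similarly for $U(p,q)$); $O^*(2n)$: size $n$, any signature, odd rows begin with $+$; $Sp(p,q)$: size $p+q$, signature $(p,q)$, even rows begin with $+$. The correspondence: a nilpotent $x$ (or $z$) has a Jordan basis consisting of strings $v,xv,\dots,x^{k-1}v$ with $x^kv=0$ of vectors lying in $V'_+$ or $V'_-$ (resp. $V_\pm$); each string gives a row of length $k$ labelled by the signs of its members. For $G'$ the signs are written from left to right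 in the order $v,xv,\dots,x^{k-1}v$; for $G$ they are written in the order $z^{k-1}v,\dots,zv,v$. This gives the full diagram. For $U$ this is the diagram of the orbit. For $Sp(2n,\mathbb{R})$ (resp. $O(p,q)$), for each odd (resp. even) length the rows beginning with $+$ and those beginning with $-$ are equal in number, and the diagram of the orbit is obtained by rewriting all of these rows as beginning with $+$. For $O^*(2n)$ (resp. $Sp(p,q)$), for each odd (resp. even) length the rows beginning with $+$ and those with $-$ are equal in number and one keeps only those beginning with $+$; rows of the other parity occur with even multiplicity for each initial sign and one keeps half of them. *)

theory Defs
  imports "HOL-Analysis.Analysis" "HOL-Library.Multiset"
begin

text \<open>The parameters \<open>p, q, m, n\<close> are the cardinalities of finite index types \<open>'p, 'q, 'm, 'n\<close>, so they
  range over all positive integers.  \<open>('a, 'b) cmat\<close> is the space of complex matrices with rows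
  indexed by \<open>'a\<close> and columns by \<open>'b\<close>; direct sums of spaces of column vectors are indexed by sum
  types.\<close>

type_synonym 'a cvec = "complex^'a"
type_synonym ('a, 'b) cmat = "complex^'b^'a"


section \<open>Block matrices\<close>

definition four_block ::
    "'a^'c^'r \<Rightarrow> 'a^'d^'r \<Rightarrow> 'a^'c^'s \<Rightarrow> 'a^'d^'s \<Rightarrow> 'a^('c::finite + 'd::finite)^('r::finite + 's::finite)"
  where "four_block A B C D = (\<chi> i j.
    case i of
      Inl a \<Rightarrow> (case j of Inl c \<Rightarrow> A $ a $ c | Inr d \<Rightarrow> B $ a $ d)
    | Inr b \<Rightarrow> (case j of Inl c \<Rightarrow> C $ b $ c | Inr d \<Rightarrow> D $ b $ d))"

definition sympl_J :: "('p + 'p, 'p::finite + 'p) cmat"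
  where "sympl_J = four_block 0 (mat 1) (- mat 1) 0"

definition nilpotent_matrix :: "('a, 'a::finite) cmat \<Rightarrow> bool"
  where "nilpotent_matrix x \<longleftrightarrow> (\<exists>k. ((\<lambda>y. x ** y) ^^ k) (mat 1) = 0)"


section \<open>Signed Young diagrams\<close>

datatype sign = Pos | Neg

fun flip_sign :: "sign \<Rightarrow> sign"
  where
    "flip_sign Pos = Neg"
  | "flip_sign Neg = Pos"

type_synonym row = "sign list"

text \<open>A diagram is a multiset of nonempty rows, so rows of equal length are unordered.\<close>

definition signed_young_diagram :: "row multiset \<Rightarrow> bool"
  where "signed_young_diagram \<Lambda> \<longleftrightarrow> (\<forall>r\<in>#\<Lambda>. r \<noteq> [] \<and> distinct_adj r)"

definition signature :: "row multiset \<Rightarrow> nat \<times> nat"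
  where "signature \<Lambda> = (\<Sum>r\<in>#\<Lambda>. count_list r Pos, \<Sum>r\<in>#\<Lambda>. count_list r Neg)"

text \<open>The signed Young diagrams for \<open>O(p,q)\<close>, \<open>U(p,q)\<close> and \<open>Sp(p,q)\<close>; the size \<open>p + q\<close> is implied by
  the signature.  For \<open>O(p,q)\<close> an even row is determined by its length, so the multiplicity
  of that length is the multiplicity of the row.\<close>

definition O_diagram :: "nat \<Rightarrow> nat \<Rightarrow> row multiset \<Rightarrow> bool"
  where "O_diagram p q \<Lambda> \<longleftrightarrow> signed_young_diagram \<Lambda> \<and> signature \<Lambda> = (p, q) \<and>
    (\<forall>r\<in>#\<Lambda>. even (length r) \<longrightarrow> hd r = Pos \<and> even (count \<Lambda> r))"

definition U_diagram :: "nat \<Rightarrow> nat \<Rightarrow> row multiset \<Rightarrow> bool"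
  where "U_diagram p q \<Lambda> \<longleftrightarrow> signed_young_diagram \<Lambda> \<and> signature \<Lambda> = (p, q)"

definition Sp_diagram :: "nat \<Rightarrow> nat \<Rightarrow> row multiset \<Rightarrow> bool"
  where "Sp_diagram p q \<Lambda> \<longleftrightarrow> signed_young_diagram \<Lambda> \<and> signature \<Lambda> = (p, q) \<and>
    (\<forall>r\<in>#\<Lambda>. even (length r) \<longrightarrow> hd r = Pos)"

text \<open>\<open>add_boxes k \<Lambda>' \<Lambda>\<close>: one box with some sign is added at the right end of each row of \<open>\<Lambda>'\<close> and of
  \<open>k\<close> empty rows.\<close>

definition add_boxes :: "nat \<Rightarrow> row multiset \<Rightarrow> row multiset \<Rightarrow> bool"
  where "add_boxes k \<Lambda>' \<Lambda> \<longleftrightarrow> rel_mset (\<lambda>r' r. \<exists>s. r = r' @ [s]) (\<Lambda>' + replicate_mset k []) \<Lambda>"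


section \<open>The diagram of a nilpotent element\<close>

definition V_plus :: "('a::finite + 'b::finite) cvec set"
  where "V_plus = {v. \<forall>j. v $ Inr j = 0}"

definition V_minus :: "('a::finite + 'b::finite) cvec set"
  where "V_minus = {v. \<forall>i. v $ Inl i = 0}"

definition vec_sign :: "('a::finite + 'b::finite) cvec \<Rightarrow> sign"
  where "vec_sign v = (if v \<in> V_plus then Pos else Neg)"

definition string_of ::
    "('a, 'a::finite) cmat \<Rightarrow> 'a cvec \<times> nat \<Rightarrow> 'a cvec list"
  where "string_of x = (\<lambda>(v, k). map (\<lambda>j. ((\<lambda>w. x *v w) ^^ j) v) [0..<k])"

text \<open>A Jordan basis is given by the list of pairs \<open>(v, k)\<close> of an initial vector \<open>v\<close> and a length
  \<open>k\<close> of its strings.  Linear independence is over the complex numbers, hence \<open>vec.independent\<close>.\<close>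

definition signed_jordan_basis ::
    "('a + 'b, 'a::finite + 'b::finite) cmat \<Rightarrow> (('a + 'b) cvec \<times> nat) list \<Rightarrow> bool"
  where "signed_jordan_basis x S \<longleftrightarrow>
    (\<forall>(v, k)\<in>set S. k \<ge> 1 \<and> ((\<lambda>w. x *v w) ^^ k) v = 0 \<and>
      set (string_of x (v, k)) \<subseteq> V_plus \<union> V_minus) \<and>
    (let B = concat (map (string_of x) S) in
      distinct B \<and> vec.independent (set B) \<and> vec.span (set B) = UNIV)"

text \<open>Full diagrams: for \<open>G'\<close> the signs of a string are written in the order \<open>v, xv, \<dots>\<close>, for \<open>G\<close>
  in the opposite order.\<close>

definition full_diagram' ::
    "('a + 'b, 'a::finite + 'b::finite) cmat \<Rightarrow> row multiset \<Rightarrow> bool"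
  where "full_diagram' x D \<longleftrightarrow> (\<exists>S. signed_jordan_basis x S \<and>
    D = mset (map (\<lambda>vk. map vec_sign (string_of x vk)) S))"

definition full_diagram ::
    "('a + 'b, 'a::finite + 'b::finite) cmat \<Rightarrow> row multiset \<Rightarrow> bool"
  where "full_diagram z D \<longleftrightarrow> (\<exists>S. signed_jordan_basis z S \<and>
    D = mset (map (\<lambda>vk. rev (map vec_sign (string_of z vk))) S))"

text \<open>Passage from full diagrams to the diagrams of orbits.  \<open>P\<close> is the parity of the exceptional
  rows: \<open>odd\<close> for \<open>G'\<close> and \<open>even\<close> for \<open>G\<close>.  \<open>rewrite_rows\<close> is used for the pair
  \<open>(O(p,q), Sp(2n,\<real>))\<close> and \<open>halve_rows\<close> for \<open>(Sp(p,q), O\<^sup>*(2n))\<close>.\<close>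

definition rewrite_rows :: "(nat \<Rightarrow> bool) \<Rightarrow> row multiset \<Rightarrow> row multiset"
  where "rewrite_rows P D =
    image_mset (\<lambda>r. if P (length r) \<and> hd r = Neg then map flip_sign r else r) D"

definition halve_rows :: "(nat \<Rightarrow> bool) \<Rightarrow> row multiset \<Rightarrow> row multiset \<Rightarrow> bool"
  where "halve_rows P D \<Lambda> \<longleftrightarrow> (\<forall>r.
    if P (length r) then count \<Lambda> r = (if hd r = Pos then count D r else 0)
    else 2 * count \<Lambda> r = count D r)"


section \<open>Orbits and theta lifts\<close>

definition nilpotent_orbit ::
    "'g set \<Rightarrow> ('g \<Rightarrow> 's \<Rightarrow> 's) \<Rightarrow> 's set \<Rightarrow> ('s \<Rightarrow> ('a, 'a::finite) cmat) \<Rightarrow> 's set \<Rightarrow> bool"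
  where "nilpotent_orbit K act \<s> assoc \<O> \<longleftrightarrow>
    (\<exists>x\<in>\<s>. nilpotent_matrix (assoc x) \<and> \<O> = {act g x | g. g \<in> K})"

text \<open>The closure is taken in the Euclidean topology; orbits being constructible, it agrees with
  the Zariski closure.\<close>

definition theta_lift ::
    "('w \<Rightarrow> 's::topological_space) \<Rightarrow> ('w \<Rightarrow> 't::topological_space) \<Rightarrow> 't set \<Rightarrow> 's set \<Rightarrow> bool"
  where "theta_lift \<phi> \<psi> \<O>' \<O> \<longleftrightarrow> \<phi> ` (\<psi> -` closure \<O>') = closure \<O>"

definition GL :: "('n, 'n::finite) cmat set"
  where "GL = {g. invertible g}"

definition O_C :: "('n, 'n::finite) cmat set"
  where "O_C = {k. orthogonal_matrix k}"

definition Sp_C :: "('n + 'n, 'n::finite + 'n) cmat set"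
  where "Sp_C = {k. transpose k ** sympl_J ** k = sympl_J}"

text \<open>The matrix associated with an element of \<open>\<s>'\<close>, for all three pairs.\<close>

definition assoc' ::
    "('m, 'n) cmat \<times> ('n, 'm) cmat \<Rightarrow> ('m + 'n, 'm::finite + 'n::finite) cmat"
  where "assoc' = (\<lambda>(X, Y). four_block 0 X Y 0)"

text \<open>\<open>act\<close> and \<open>act'\<close> are the actions of \<open>K\<^sub>C\<close> on \<open>\<s>\<close> and of \<open>K'\<^sub>C\<close> on \<open>\<s>'\<close> for the pairs
  \<open>(O(p,q), Sp(2n,\<real>))\<close> and \<open>(Sp(p,q), O\<^sup>*(2n))\<close>; \<open>act_U\<close> is both actions for \<open>(U(p,q), U(m,n))\<close>.\<close>

definition act ::
    "('p, 'p) cmat \<times> ('q, 'q) cmat \<Rightarrow> ('p::finite, 'q::finite) cmat \<Rightarrow> ('p, 'q) cmat"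
  where "act = (\<lambda>(k\<^sub>1, k\<^sub>2) Z. k\<^sub>1 ** Z ** matrix_inv k\<^sub>2)"

definition act' ::
    "('n, 'n::finite) cmat \<Rightarrow> ('n, 'n) cmat \<times> ('n, 'n) cmat \<Rightarrow> ('n, 'n) cmat \<times> ('n, 'n) cmat"
  where "act' g = (\<lambda>(X, Y).
    (g ** X ** transpose g, matrix_inv (transpose g) ** Y ** matrix_inv g))"

definition act_U ::
    "('p, 'p) cmat \<times> ('q, 'q) cmat \<Rightarrow> ('p::finite, 'q::finite) cmat \<times> ('q, 'p) cmat \<Rightarrow>
      ('p, 'q) cmat \<times> ('q, 'p) cmat"
  where "act_U = (\<lambda>(g\<^sub>1, g\<^sub>2) (Z\<^sub>1, Z\<^sub>2).
    (g\<^sub>1 ** Z\<^sub>1 ** matrix_inv g\<^sub>2, g\<^sub>2 ** Z\<^sub>2 ** matrix_inv g\<^sub>1))"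


subsection \<open>\<open>O(p,q)\<close> and \<open>Sp(2n,\<real>)\<close>\<close>

definition phi_O :: "('p::finite, 'n::finite) cmat \<times> ('q::finite, 'n) cmat \<Rightarrow> ('p, 'q) cmat"
  where "phi_O = (\<lambda>(A, B). A ** transpose B)"

definition psi_O ::
    "('p::finite, 'n::finite) cmat \<times> ('q::finite, 'n) cmat \<Rightarrow> ('n, 'n) cmat \<times> ('n, 'n) cmat"
  where "psi_O = (\<lambda>(A, B). (transpose A ** A, transpose B ** B))"

definition assoc_O :: "('p::finite, 'q::finite) cmat \<Rightarrow> ('p + 'q, 'p + 'q) cmat"
  where "assoc_O Z = four_block 0 Z (- transpose Z) 0"

definition nilp_orbit_O :: "('p::finite, 'q::finite) cmat set \<Rightarrow> bool"
  where "nilp_orbit_O = nilpotent_orbit (O_C \<times> O_C) act UNIV assoc_O"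

definition nilp_orbit_O' :: "(('n, 'n::finite) cmat \<times> ('n, 'n) cmat) set \<Rightarrow> bool"
  where "nilp_orbit_O' =
    nilpotent_orbit GL act' {(X, Y). transpose X = X \<and> transpose Y = Y} assoc'"

definition orbit_diagram_O :: "('p::finite, 'q::finite) cmat set \<Rightarrow> row multiset \<Rightarrow> bool"
  where "orbit_diagram_O \<O> \<Lambda> \<longleftrightarrow>
    (\<forall>Z\<in>\<O>. \<exists>D. full_diagram (assoc_O Z) D \<and> \<Lambda> = rewrite_rows even D)"

definition orbit_diagram_O' ::
    "(('n, 'n::finite) cmat \<times> ('n, 'n) cmat) set \<Rightarrow> row multiset \<Rightarrow> bool"
  where "orbit_diagram_O' \<O>' \<Lambda>' \<longleftrightarrow>
    (\<forall>x\<in>\<O>'. \<exists>D. full_diagram' (assoc' x) D \<and> \<Lambda>' = rewrite_rows odd D)"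


subsection \<open>\<open>U(p,q)\<close> and \<open>U(m,n)\<close>\<close>

definition phi_U ::
    "(('p::finite, 'm::finite) cmat \<times> ('p, 'n::finite) cmat) \<times>
     (('q::finite, 'm) cmat \<times> ('q, 'n) cmat) \<Rightarrow> ('p, 'q) cmat \<times> ('q, 'p) cmat"
  where "phi_U = (\<lambda>((A, B), (C, D)). (A ** transpose C, D ** transpose B))"

definition psi_U ::
    "(('p::finite, 'm::finite) cmat \<times> ('p, 'n::finite) cmat) \<times>
     (('q::finite, 'm) cmat \<times> ('q, 'n) cmat) \<Rightarrow> ('m, 'n) cmat \<times> ('n, 'm) cmat"
  where "psi_U = (\<lambda>((A, B), (C, D)). (transpose A ** B, transpose D ** C))"

definition assoc_U ::
    "('p::finite, 'q::finite) cmat \<times> ('q, 'p) cmat \<Rightarrow> ('p + 'q, 'p + 'q) cmat"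
  where "assoc_U = (\<lambda>(Z\<^sub>1, Z\<^sub>2). four_block 0 Z\<^sub>1 Z\<^sub>2 0)"

definition nilp_orbit_U :: "(('p::finite, 'q::finite) cmat \<times> ('q, 'p) cmat) set \<Rightarrow> bool"
  where "nilp_orbit_U = nilpotent_orbit (GL \<times> GL) act_U UNIV assoc_U"

definition nilp_orbit_U' :: "(('m::finite, 'n::finite) cmat \<times> ('n, 'm) cmat) set \<Rightarrow> bool"
  where "nilp_orbit_U' = nilpotent_orbit (GL \<times> GL) act_U UNIV assoc'"

definition orbit_diagram_U ::
    "(('p::finite, 'q::finite) cmat \<times> ('q, 'p) cmat) set \<Rightarrow> row multiset \<Rightarrow> bool"
  where "orbit_diagram_U \<O> \<Lambda> \<longleftrightarrow> (\<forall>Z\<in>\<O>. full_diagram (assoc_U Z) \<Lambda>)"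

definition orbit_diagram_U' ::
    "(('m::finite, 'n::finite) cmat \<times> ('n, 'm) cmat) set \<Rightarrow> row multiset \<Rightarrow> bool"
  where "orbit_diagram_U' \<O>' \<Lambda>' \<longleftrightarrow> (\<forall>x\<in>\<O>'. full_diagram' (assoc' x) \<Lambda>')"


subsection \<open>\<open>Sp(p,q)\<close> and \<open>O\<^sup>*(2n)\<close>\<close>

definition phi_Sp ::
    "('p::finite + 'p, 'n::finite) cmat \<times> ('q::finite + 'q, 'n) cmat \<Rightarrow>
      ('p + 'p, 'q + 'q) cmat"
  where "phi_Sp = (\<lambda>(A, B). A ** transpose B)"

definition psi_Sp ::
    "('p::finite + 'p, 'n::finite) cmat \<times> ('q::finite + 'q, 'n) cmat \<Rightarrow>
      ('n, 'n) cmat \<times> ('n, 'n) cmat"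
  where "psi_Sp = (\<lambda>(A, B). (transpose A ** sympl_J ** A, transpose B ** sympl_J ** B))"

definition assoc_Sp ::
    "('p::finite + 'p, 'q::finite + 'q) cmat \<Rightarrow>
      (('p + 'p) + ('q + 'q), ('p + 'p) + ('q + 'q)) cmat"
  where "assoc_Sp Z = four_block 0 Z (sympl_J ** transpose Z ** sympl_J) 0"

definition nilp_orbit_Sp :: "('p::finite + 'p, 'q::finite + 'q) cmat set \<Rightarrow> bool"
  where "nilp_orbit_Sp = nilpotent_orbit (Sp_C \<times> Sp_C) act UNIV assoc_Sp"

definition nilp_orbit_Sp' :: "(('n, 'n::finite) cmat \<times> ('n, 'n) cmat) set \<Rightarrow> bool"
  where "nilp_orbit_Sp' =
    nilpotent_orbit GL act' {(X, Y). transpose X = - X \<and> transpose Y = - Y} assoc'"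

definition orbit_diagram_Sp ::
    "('p::finite + 'p, 'q::finite + 'q) cmat set \<Rightarrow> row multiset \<Rightarrow> bool"
  where "orbit_diagram_Sp \<O> \<Lambda> \<longleftrightarrow>
    (\<forall>Z\<in>\<O>. \<exists>D. full_diagram (assoc_Sp Z) D \<and> halve_rows even D \<Lambda>)"

definition orbit_diagram_Sp' ::
    "(('n, 'n::finite) cmat \<times> ('n, 'n) cmat) set \<Rightarrow> row multiset \<Rightarrow> bool"
  where "orbit_diagram_Sp' \<O>' \<Lambda>' \<longleftrightarrow>
    (\<forall>x\<in>\<O>'. \<exists>D. full_diagram' (assoc' x) D \<and> halve_rows odd D \<Lambda>')"

end

theory Submission
  imports Defs
begin

text \<open>A signed Young diagram is determined by the ranks of the powers of a nilpotent element on
  the two graded pieces (\<open>pow_dim\<close>), so the classification of orbits is not needed.  A point of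
  \<open>W\<close> is a pair of maps \<open>T : V' \<rightarrow> V\<close> and \<open>S : V \<rightarrow> V'\<close>, of degree \<open>0\<close> and \<open>1\<close>, such that
  \<open>\<phi>\<close> gives \<open>z = T S\<close> and \<open>\<psi>\<close> gives \<open>S T\<close>, which is the transpose of \<open>x\<close> up to a scalar.
  As \<open>z\<^sup>k\<^sup>+\<^sup>1 = T (S T)\<^sup>k S\<close>, the ranks of \<open>z\<^sup>k\<^sup>+\<^sup>1\<close> are at most those of \<open>x\<^sup>k\<close>, with equality when
  \<open>T\<close> is injective and \<open>S\<close> is surjective; in the stable range such a point exists over every \<open>x\<close>.
  Lower semicontinuity of the rank transfers this to all of \<open>\<O>\<close>.  Raising the exponent by one
  means that \<open>x\<close> has the diagram of \<open>z\<close> with the last box of each row removed, and since the signs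
  alternate, the signature determines the remaining rows of length one.\<close>

section \<open>Linear algebra\<close>

text \<open>The transposition between \<open>S T\<close> and \<open>x\<close> exchanges the first
  and the last vectors of strings. This is why rows are read in opposite directions for the two
  groups, why ranks are compared with the sign shift \<open>flip_sign ^^ Suc k\<close>, and why the
  new box stands at the right end of a row although it belongs to the initial vector of a string of
  \<open>z\<close>. The factorization meets a sign obstacle for the orthogonal pair: the lower block
  \<open>- transpose Z\<close> is split with a factor \<i> on each side, which makes \<i> the common
  scalar; the unitary and symplectic pairs give 1 and -1. Ranks determine full diagrams, whereas
  orbit diagrams in the orthogonal and symplectic cases record less. There the odd rows of the full
  diagram of \<open>x\<close> have to be balanced between the two initial signs. An intertwiner of
  \<open>x\<close> with its transpose that swaps the two pieces provides this; it exists because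
  \<open>X\<close> and \<open>Y\<close> are symmetric or alternating.\<close>

lemma vec_dim_image_le:
  fixes M :: "'a::field^'n^'m"
  shows "vec.dim ((*v) M ` U) \<le> vec.dim U"
  by (rule vec.dim_image_le) simp

lemma vec_dim_image_inj:
  fixes M :: "'a::field^'n^'m"
  assumes "inj ((*v) M)"
  shows "vec.dim ((*v) M ` U) = vec.dim U"
  by (rule vec.dim_image_eq) (use assms in \<open>auto intro: inj_on_subset\<close>)

lemma vec_subspace_image:
  fixes M :: "'a::field^'n^'m"
  assumes "vec.subspace U"
  shows "vec.subspace ((*v) M ` U)"
  using assms by (rule vec.subspace_image)

lemma vec_subspace_kernel:
  fixes M :: "'a::field^'n^'m"
  assumes "vec.subspace U"
  shows "vec.subspace {u \<in> U. M *v u = 0}"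
  using assms by (auto simp: vec.subspace_def vec.add vec.scale)

text \<open>A linear right inverse \<open>g\<close> of \<open>M\<close> on the image of
  \<open>U\<close> embeds that image in \<open>U\<close>, where it meets the kernel only in 0. This
  half of the rank formula is the one that is used.\<close>

lemma vec_rank_nullity_le:
  fixes M :: "'a::field^'n^'m"
  assumes "vec.subspace U"
  shows "vec.dim ((*v) M ` U) + vec.dim {u \<in> U. M *v u = 0} \<le> vec.dim U"
proof -
  let ?K = "{u \<in> U. M *v u = 0}"
  obtain g where g: "g ` UNIV \<subseteq> U" "Vector_Spaces.linear (*s) (*s) g"
    "\<forall>v\<in>(*v) M ` U. M *v (g v) = v"
    using vec.linear_exists_right_inverse_on[OF matrix_vector_mul_linear_gen assms] by blast
  interpret g: Vector_Spaces.linear "(*s)" "(*s)" g by (fact g(2))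
  let ?R = "(*v) M ` U"
  have R: "vec.subspace ?R" by (rule vec_subspace_image[OF assms])
  have inj: "inj_on g (vec.span ?R)"
    using g(3) R by (metis inj_onI vec.span_eq_iff)
  have gR: "vec.subspace (g ` ?R)" using g.subspace_image[OF R] .
  have K: "vec.subspace ?K" by (rule vec_subspace_kernel[OF assms])
  have "g ` ?R \<inter> ?K \<subseteq> {0}"
    using g(3) g.zero by force
  then have "vec.dim (g ` ?R \<inter> ?K) = 0"
    by (subst vec.dim_eq_0)
  then have "vec.dim ?R + vec.dim ?K = vec.dim {x + y |x y. x \<in> g ` ?R \<and> y \<in> ?K}"
    using vec.dim_sums_Int[OF gR K] vec.dim_image_eq[OF g(2) inj] by linarith
  also have "\<dots> \<le> vec.dim U"
  proof (rule vec.dim_subset)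
    show "{x + y |x y. x \<in> g ` ?R \<and> y \<in> ?K} \<subseteq> U"
      using g(1) assms by (auto simp: vec.subspace_def)
  qed
  finally show ?thesis .
qed

text \<open>Writing the columns of \<open>M\<close> in a basis \<open>B\<close> of its column space exhibits the columns of
  \<open>transpose M\<close> as combinations of \<open>card B\<close> coordinate vectors.\<close>

lemma vec_dim_range_transpose_le:
  fixes M :: "'a::field^'n^'m"
  shows "vec.dim (range ((*v) (transpose M))) \<le> vec.dim (range ((*v) M))"
proof -
  obtain B where B: "B \<subseteq> range ((*v) M)" "vec.independent B" "range ((*v) M) \<subseteq> vec.span B"
    "card B = vec.dim (range ((*v) M))"
    using vec.basis_exists[of "range ((*v) M)"] by auto
  have finB: "finite B" using B(2) by (rule vec.finiteI_independent)
  have "\<exists>r. M *v axis j 1 = (\<Sum>b\<in>B. r b *s b)" for j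
    using B(3) vec.span_finite[OF finB] by (metis (no_types, lifting) imageE rangeI subsetD)
  then obtain R where R: "\<And>j. M *v axis j 1 = (\<Sum>b\<in>B. R j b *s b)" by metis
  have M: "M $ i $ j = (\<Sum>b\<in>B. R j b * b $ i)" for i j
  proof -
    have "(M *v axis j 1) $ i = M $ i $ j"
      by (simp add: matrix_vector_mult_def axis_def if_distrib cong: if_cong)
    then show ?thesis by (simp add: R)
  qed
  let ?c = "\<lambda>b. \<chi> j. R j b"
  have "transpose M *v w \<in> vec.span (?c ` B)" for w
  proof -
    have "transpose M *v w = (\<Sum>b\<in>B. (\<Sum>i\<in>UNIV. b $ i * w $ i) *s ?c b)"
      by (simp add: vec_eq_iff matrix_vector_mult_def transpose_def M sum_distrib_left
          sum_distrib_right sum.swap[of _ UNIV B] algebra_simps del: transpose_matrix_vector)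
    also have "\<dots> \<in> vec.span (?c ` B)"
      by (intro vec.span_sum vec.span_scale vec.span_base) auto
    finally show ?thesis .
  qed
  then have "vec.dim (range ((*v) (transpose M))) \<le> card (?c ` B)"
    using finB by (intro vec.dim_le_card) auto
  also have "\<dots> \<le> vec.dim (range ((*v) M))"
    using B(4) card_image_le[OF finB] by metis
  finally show ?thesis .
qed

lemma vec_dim_range_transpose:
  fixes M :: "'a::field^'n^'m"
  shows "vec.dim (range ((*v) (transpose M))) = vec.dim (range ((*v) M))"
  using vec_dim_range_transpose_le[of M] vec_dim_range_transpose_le[of "transpose M"]
  by (simp del: transpose_matrix_vector)

section \<open>Continuity of matrix operations and semicontinuity of the rank\<close>

lemma continuous_on_matrix_mult [continuous_intros]:
  fixes f :: "_ \<Rightarrow> 'a::real_normed_algebra_1^'n^'m"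
  assumes "continuous_on S f" "continuous_on S g"
  shows "continuous_on S (\<lambda>y. f y ** g y)"
  unfolding matrix_matrix_mult_def
  by (intro continuous_on_vec_lambda continuous_on_sum continuous_on_mult
      continuous_on_component assms)

lemma continuous_on_transpose [continuous_intros]:
  fixes f :: "_ \<Rightarrow> 'a::topological_space^'n^'m"
  assumes "continuous_on S f"
  shows "continuous_on S (\<lambda>y. transpose (f y))"
  unfolding transpose_def
  by (intro continuous_on_vec_lambda continuous_on_component assms)

lemma continuous_on_det [continuous_intros]:
  fixes f :: "_ \<Rightarrow> complex^'n^'n"
  assumes "continuous_on S f"
  shows "continuous_on S (\<lambda>y. det (f y))"
  unfolding det_def
  by (intro continuous_intros continuous_on_component assms)

text \<open>With \<open>N\<close> a right inverse of \<open>f z\<close> on the image of \<open>U\<close> and \<open>E = 1 - f z N\<close>, the matrix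
  \<open>f y N + E\<close> is the identity at \<open>y = z\<close>, hence invertible near \<open>z\<close>; this bounds the dimension
  of the image of \<open>U\<close> under \<open>f y\<close> from below.\<close>

lemma dim_image_closure_le:
  fixes f :: "'s::topological_space \<Rightarrow> complex^'n^'m"
  assumes cont: "continuous_on UNIV f" and U: "vec.subspace U"
    and z: "z \<in> closure S" and le: "\<And>y. y \<in> S \<Longrightarrow> vec.dim ((*v) (f y) ` U) \<le> r"
  shows "vec.dim ((*v) (f z) ` U) \<le> r"
proof -
  let ?W = "(*v) (f z) ` U"
  obtain g where g: "g ` UNIV \<subseteq> U" "Vector_Spaces.linear (*s) (*s) g"
    "\<forall>v\<in>?W. f z *v (g v) = v"
    using vec.linear_exists_right_inverse_on[OF matrix_vector_mul_linear_gen U] by blast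
  define N where "N = matrix g"
  have N: "N *v w = g w" for w unfolding N_def by (rule matrix_works[OF g(2)])
  define E where "E = mat 1 - f z ** N"
  have EW: "E *v w = 0" if "w \<in> ?W" for w
    using g(3)[rule_format, OF that] by (simp add: E_def matrix_vector_mult_diff_rdistrib N
        flip: matrix_vector_mul_assoc)
  have W: "vec.subspace ?W" by (rule vec_subspace_image[OF U])
  \<comment> \<open>Since \<open>f z ** N\<close> fixes \<open>?W\<close> pointwise,
    \<open>?W\<close> lies in the kernel of \<open>E\<close>. This caps the rank of
    \<open>E\<close>, the summand that does not come from \<open>U\<close>.\<close>
  have "vec.dim ?W \<le> vec.dim {u \<in> UNIV. E *v u = 0}"
    by (rule vec.dim_subset) (use EW in auto)
  then have dimE: "vec.dim (range ((*v) E)) + vec.dim ?W \<le> CARD('m)"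
    using vec_rank_nullity_le[of UNIV E] by (simp add: vec.subspace_UNIV vec_dim_card del: vec.dim_UNIV)
  define A where "A = {y. det (f y ** N + E) \<noteq> 0}"
  have "open A"
  proof -
    have "A = (\<lambda>y. det (f y ** N + E)) -` (- {0})" by (auto simp: A_def)
    moreover have "continuous_on UNIV (\<lambda>y. det (f y ** N + E))"
      by (intro continuous_intros cont)
    ultimately show ?thesis by (metis open_Compl closed_singleton open_vimage)
  qed
  moreover have "z \<in> A" by (simp add: A_def E_def)
  ultimately obtain y where y: "y \<in> S" "y \<in> A"
    using z by (meson closure_iff_nhds_not_empty subset_refl disjoint_iff)
  let ?Y = "(*v) (f y) ` U"
  have Y: "vec.subspace ?Y" by (rule vec_subspace_image[OF U])
  have RE: "vec.subspace (range ((*v) E))" by (rule vec_subspace_image) (rule vec.subspace_UNIV)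
  have "invertible (f y ** N + E)" using y(2) by (simp add: A_def invertible_det_nz)
  then have "surj ((*v) (f y ** N + E))" by (simp add: invertible_eq_bij bij_def)
  then have "UNIV \<subseteq> {a + b |a b. a \<in> ?Y \<and> b \<in> range ((*v) E)}"
  proof -
    assume surj: "surj ((*v) (f y ** N + E))"
    have "v \<in> {a + b |a b. a \<in> ?Y \<and> b \<in> range ((*v) E)}" for v
    proof -
      obtain u where "v = (f y ** N + E) *v u" using surj by (metis surjD)
      then have "v = f y *v (g u) + E *v u"
        by (simp add: matrix_vector_mult_add_rdistrib N flip: matrix_vector_mul_assoc)
      then show ?thesis using g(1) by blast
    qed
    then show ?thesis by blast
  qed
  then have "CARD('m) \<le> vec.dim {a + b |a b. a \<in> ?Y \<and> b \<in> range ((*v) E)}"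
    using vec.dim_subset[of UNIV] by (simp only: vec_dim_card)
  also have "\<dots> \<le> vec.dim ?Y + vec.dim (range ((*v) E))"
    using vec.dim_sums_Int[OF Y RE] by linarith
  also have "\<dots> \<le> r + vec.dim (range ((*v) E))" using le[OF y(1)] by simp
  finally show ?thesis using dimE by linarith
qed

section \<open>Graded matrices\<close>

fun index_sign :: "'a + 'b \<Rightarrow> sign"
  where
    "index_sign (Inl _) = Pos"
  | "index_sign (Inr _) = Neg"

definition sign_space :: "sign \<Rightarrow> ('a::finite + 'b::finite) cvec set"
  where "sign_space e = {v. \<forall>i. index_sign i \<noteq> e \<longrightarrow> v $ i = 0}"

lemma flip_sign_flip_sign [simp]: "flip_sign (flip_sign e) = e"
  by (cases e) auto

lemma flip_sign_neq [simp]: "flip_sign e \<noteq> e" "e \<noteq> flip_sign e"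
  by (cases e; simp)+

lemma neq_flip_sign: "e \<noteq> d \<longleftrightarrow> d = flip_sign e"
  by (cases e; cases d) auto

lemma flip_sign_pow_flip_sign_pow [simp]: "(flip_sign ^^ k) ((flip_sign ^^ k) e) = e"
  by (induction k arbitrary: e) (auto simp: funpow_swap1)

lemma V_plus_eq: "V_plus = (sign_space Pos :: ('a::finite + 'b::finite) cvec set)"
  and V_minus_eq: "V_minus = (sign_space Neg :: ('a::finite + 'b::finite) cvec set)"
proof -
  have "index_sign i \<noteq> Pos \<longleftrightarrow> (\<exists>j. i = Inr j)" "index_sign i \<noteq> Neg \<longleftrightarrow> (\<exists>j. i = Inl j)"
    for i :: "'a + 'b"
    by (cases i; auto)+
  then show "V_plus = (sign_space Pos :: ('a + 'b) cvec set)"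
    "V_minus = (sign_space Neg :: ('a + 'b) cvec set)"
    by (auto simp: V_plus_def V_minus_def sign_space_def)
qed

lemma subspace_sign_space: "vec.subspace (sign_space e)"
  by (auto simp: vec.subspace_def sign_space_def)

lemma sign_space_Int: "v \<in> sign_space e \<Longrightarrow> v \<in> sign_space (flip_sign e) \<Longrightarrow> v = 0"
  by (auto simp: sign_space_def vec_eq_iff) (metis flip_sign_neq(1))

lemma dim_sign_space:
  "vec.dim (sign_space Pos :: ('a::finite + 'b::finite) cvec set) = CARD('a)"
  "vec.dim (sign_space Neg :: ('a::finite + 'b::finite) cvec set) = CARD('b)"
proof -
  have *: "sign_space e = {x :: ('a + 'b) cvec. \<forall>i. i \<notin> {i. index_sign i = e} \<longrightarrow> x $ i = 0}" for e
    by (auto simp: sign_space_def)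
  have "{i :: 'a + 'b. index_sign i = Pos} = range Inl" "{i :: 'a + 'b. index_sign i = Neg} = range Inr"
    by (auto elim!: index_sign.elims)
  then show "vec.dim (sign_space Pos :: ('a + 'b) cvec set) = CARD('a)"
    "vec.dim (sign_space Neg :: ('a + 'b) cvec set) = CARD('b)"
    unfolding * dim_substandard_cart by (auto simp: card_image)
qed

lemma vec_sign_eq:
  assumes "v \<in> sign_space e" "v \<noteq> 0"
  shows "vec_sign v = e"
proof (cases e)
  case Neg
  then have "v \<notin> sign_space Pos" using sign_space_Int[of v Neg] assms by auto
  then show ?thesis using Neg by (simp add: vec_sign_def V_plus_eq)
qed (use assms in \<open>simp add: vec_sign_def V_plus_eq\<close>)

lemma vec_sign_space:
  assumes "v \<in> V_plus \<union> V_minus"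
  shows "v \<in> sign_space (vec_sign v)"
  using assms by (auto simp: vec_sign_def V_plus_eq V_minus_eq)

text \<open>The degree is encoded as a map on signs: \<open>id\<close> for degree 0,
  \<open>flip_sign\<close> for degree 1. Degrees of products are then compositions.\<close>

definition graded :: "(sign \<Rightarrow> sign) \<Rightarrow> ('a::finite + 'b::finite, 'c::finite + 'd::finite) cmat \<Rightarrow> bool"
  where "graded f M \<longleftrightarrow> (\<forall>i j. M $ i $ j \<noteq> 0 \<longrightarrow> index_sign i = f (index_sign j))"

lemma gradedD: "graded f M \<Longrightarrow> index_sign i \<noteq> f (index_sign j) \<Longrightarrow> M $ i $ j = 0"
  by (auto simp: graded_def)

lemma graded_matrix_mult:
  assumes "graded f M" "graded g N"
  shows "graded (f \<circ> g) (M ** N)"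
  unfolding graded_def
proof (intro allI impI)
  fix i j assume "(M ** N) $ i $ j \<noteq> 0"
  then obtain k where "M $ i $ k * N $ k $ j \<noteq> 0"
    by (auto simp: matrix_matrix_mult_def elim: sum.not_neutral_contains_not_neutral)
  then show "index_sign i = (f \<circ> g) (index_sign j)"
    using assms by (auto simp: graded_def)
qed

lemma graded_image:
  assumes "graded f M" "v \<in> sign_space e"
  shows "M *v v \<in> sign_space (f e)"
proof -
  have "M $ i $ j * v $ j = 0" if "index_sign i \<noteq> f e" for i j
    using that assms by (cases "index_sign j = e") (auto simp: sign_space_def gradedD)
  then show ?thesis
    by (auto simp: sign_space_def matrix_vector_mult_def intro!: sum.neutral)
qed

lemma graded_mat_1: "graded id (mat 1)"
  by (auto simp: graded_def mat_def)

lemma graded_four_block: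
  "graded id (four_block A 0 0 D)" "graded flip_sign (four_block 0 B C 0)"
  by (simp_all add: graded_def four_block_def split_sum_all)

text \<open>Projecting by a matrix turns the rank on a graded piece into the rank of a matrix
  product, which can be transposed.\<close>

definition sign_proj :: "sign \<Rightarrow> ('a::finite + 'b::finite, 'a + 'b) cmat"
  where "sign_proj e = (\<chi> i j. if i = j \<and> index_sign i = e then 1 else 0)"

lemma transpose_sign_proj: "transpose (sign_proj e) = sign_proj e"
  by (auto simp: sign_proj_def transpose_def vec_eq_iff)

lemma sign_proj_mult:
  "(sign_proj e ** M) $ i $ j = (if index_sign i = e then M $ i $ j else 0)"
  "(N ** sign_proj e) $ i $ j = (if index_sign j = e then N $ i $ j else 0)"
  by (auto simp: matrix_matrix_mult_def sign_proj_def if_distrib if_distribR sum.delta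
      cong: if_cong conj_cong intro!: sum.neutral)

lemma sign_proj_vec: "(sign_proj e *v v) $ i = (if index_sign i = e then v $ i else 0)"
  by (auto simp: matrix_vector_mult_def sign_proj_def if_distrib if_distribR sum.delta
      cong: if_cong conj_cong intro!: sum.neutral)

lemma sign_proj_in: "sign_proj e *v v \<in> sign_space e"
  by (auto simp: sign_space_def sign_proj_vec)

lemma sign_proj_add: "sign_proj Pos *v v + sign_proj Neg *v v = v"
  using sign.exhaust by (auto simp: vec_eq_iff sign_proj_vec)

lemma range_sign_proj: "range ((*v) (sign_proj e)) = sign_space e"
proof -
  have "v = sign_proj e *v v" if "v \<in> sign_space e" for v :: "('a + 'b) cvec"
    using that by (auto simp: vec_eq_iff sign_proj_vec sign_space_def)
  then show ?thesis using sign_proj_in by blast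
qed

lemma graded_sign_proj:
  assumes "graded f M" "inj f"
  shows "sign_proj (f e) ** M = M ** sign_proj e"
  using assms by (auto simp: vec_eq_iff sign_proj_mult dest: gradedD injD) (metis gradedD injD)+

section \<open>Ranks of powers on the two graded pieces\<close>

definition matrix_pow :: "('a, 'a::finite) cmat \<Rightarrow> nat \<Rightarrow> ('a, 'a) cmat"
  where "matrix_pow x k = ((\<lambda>y. x ** y) ^^ k) (mat 1)"

lemma matrix_pow_simps [simp]:
  "matrix_pow x 0 = mat 1" "matrix_pow x (Suc k) = x ** matrix_pow x k"
  by (simp_all add: matrix_pow_def)

lemma matrix_pow_commute: "matrix_pow x k ** x = x ** matrix_pow x k"
  by (induction k) (simp_all flip: matrix_mul_assoc)

lemma matrix_pow_vec: "matrix_pow x k *v v = ((*v) x ^^ k) v"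
  by (induction k) (simp_all flip: matrix_vector_mul_assoc)

lemma transpose_matrix_pow: "transpose (matrix_pow x k) = matrix_pow (transpose x) k"
  by (induction k) (simp_all add: matrix_transpose_mul matrix_pow_commute flip: matrix_pow_commute)

lemma graded_matrix_pow:
  assumes "graded flip_sign x"
  shows "graded (flip_sign ^^ k) (matrix_pow x k)"
proof (induction k)
  case 0
  show ?case using graded_mat_1 by (simp add: id_def)
next
  case (Suc k)
  show ?case using graded_matrix_mult[OF assms Suc] by (simp add: comp_def)
qed

lemma continuous_on_matrix_pow [continuous_intros]:
  assumes "continuous_on S f"
  shows "continuous_on S (\<lambda>y. matrix_pow (f y) k)"
  by (induction k) (auto intro!: continuous_intros assms)

definition pow_dim :: "('a::finite + 'b::finite, 'a + 'b) cmat \<Rightarrow> nat \<Rightarrow> sign \<Rightarrow> nat"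
  where "pow_dim x k e = vec.dim (((*v) x ^^ k) ` sign_space e)"

lemma pow_dim_eq_range: "pow_dim x k e = vec.dim (range ((*v) (matrix_pow x k ** sign_proj e)))"
proof -
  have "range ((*v) (matrix_pow x k ** sign_proj e)) = (*v) (matrix_pow x k) ` range ((*v) (sign_proj e))"
    by (auto simp flip: matrix_vector_mul_assoc)
  then show ?thesis
    by (simp add: pow_dim_def range_sign_proj matrix_pow_vec[abs_def])
qed

text \<open>Restricting the source of the transposed power means restricting the target of the power
  itself. A homogeneous map commutes with the projections up to its degree, so the restriction moves
  back to the source with a shift of sign by \<open>k\<close>.\<close>

lemma pow_dim_transpose:
  assumes "graded flip_sign x"
  shows "pow_dim (transpose x) k e = pow_dim x k ((flip_sign ^^ k) e)"
proof -
  have inj: "inj (flip_sign ^^ k)"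
    by (metis flip_sign_pow_flip_sign_pow injI)
  have "pow_dim (transpose x) k e = vec.dim (range ((*v) (transpose (sign_proj e ** matrix_pow x k))))"
    by (simp only: pow_dim_eq_range matrix_transpose_mul transpose_sign_proj transpose_matrix_pow)
  also have "\<dots> = vec.dim (range ((*v) (sign_proj e ** matrix_pow x k)))"
    by (rule vec_dim_range_transpose)
  also have "sign_proj e ** matrix_pow x k = matrix_pow x k ** sign_proj ((flip_sign ^^ k) e)"
    using graded_sign_proj[OF graded_matrix_pow[OF assms] inj, of "(flip_sign ^^ k) e"] by simp
  finally show ?thesis by (simp only: pow_dim_eq_range)
qed

text \<open>The map \<open>f\<close> is \<open>id\<close> for the group actions and
  \<open>flip_sign\<close> for the intertwiner that exchanges the two pieces.\<close>

lemma pow_dim_conj: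
  fixes h :: "('a::finite + 'b::finite, 'c::finite + 'd::finite) cmat"
  assumes hz: "h ** z = z' ** h" and h: "graded f h" "graded f h'" "h ** h' = mat 1" "h' ** h = mat 1"
    and f: "\<And>e. f (f e) = e"
  shows "pow_dim z' k (f e) = pow_dim z k e"
proof -
  have inj: "inj ((*v) h)"
    by (rule inj_on_inverseI[where g = "(*v) h'"]) (simp add: matrix_vector_mul_assoc h)
  have pow: "((*v) z' ^^ k) (h *v v) = h *v ((*v) z ^^ k) v" for v
    by (induction k) (simp_all add: matrix_vector_mul_assoc hz)
  have "sign_space (f e) \<subseteq> (*v) h ` sign_space e"
  proof
    fix v :: "('a + 'b) cvec" assume v: "v \<in> sign_space (f e)"
    then have "h' *v v \<in> sign_space e" using graded_image[OF h(2) v] f by simp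
    moreover have "v = h *v (h' *v v)" by (simp add: matrix_vector_mul_assoc h)
    ultimately show "v \<in> (*v) h ` sign_space e" by blast
  qed
  then have "sign_space (f e) = (*v) h ` sign_space e"
    using graded_image[OF h(1)] by blast
  then have "((*v) z' ^^ k) ` sign_space (f e) = (*v) h ` ((*v) z ^^ k) ` sign_space e"
    by (simp add: image_image pow)
  then show ?thesis
    by (simp add: pow_dim_def vec_dim_image_inj[OF inj])
qed

lemma pow_dim_closure_le:
  assumes "continuous_on UNIV f" "z \<in> closure S" "\<And>y. y \<in> S \<Longrightarrow> pow_dim (f y) k e \<le> r"
  shows "pow_dim (f z) k e \<le> r"
proof -
  have *: "pow_dim (f y) k e = vec.dim ((*v) (matrix_pow (f y) k) ` sign_space e)" for y
    by (simp add: pow_dim_def matrix_pow_vec[abs_def])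
  show ?thesis unfolding *
    by (rule dim_image_closure_le[OF _ subspace_sign_space assms(2)])
      (use assms(3) in \<open>auto simp: * intro!: continuous_intros assms(1)\<close>)
qed

lemma image_scale_subspace:
  fixes W :: "('a::field^'n) set"
  assumes "vec.subspace W" "a \<noteq> 0"
  shows "(*s) a ` W = W"
proof
  show "W \<subseteq> (*s) a ` W"
  proof
    fix w assume "w \<in> W"
    then have "inverse a *s w \<in> W" "w = a *s (inverse a *s w)"
      using assms by (auto simp: vec.subspace_def)
    then show "w \<in> (*s) a ` W" by blast
  qed
qed (use assms in \<open>auto simp: vec.subspace_def\<close>)

text \<open>By induction the power of \<open>z\<close> is \<open>c ^ k\<close> times the composite
  of \<open>S\<close>, the \<open>k\<close>-th power of \<open>y\<close> and \<open>T\<close>. The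
  nonzero scalar then disappears, because a subspace is stable under scaling.\<close>

lemma pow_dim_lift_image:
  assumes z: "z = T ** S" and ST: "\<And>v. S *v (T *v v) = c *s (y *v v)" "c \<noteq> 0"
  shows "((*v) z ^^ Suc k) ` sign_space e = (*v) T ` ((*v) y ^^ k) ` (*v) S ` sign_space e"
proof -
  have ST': "S *v (T *v (a *s v)) = (a * c) *s (y *v v)" for a v
    by (simp add: vec.scale ST(1))
  have "((*v) z ^^ Suc k) v = T *v (c ^ k *s ((*v) y ^^ k) (S *v v))" for v
    by (induction k) (simp_all add: z ST' mult.commute flip: matrix_vector_mul_assoc)
  then have "((*v) z ^^ Suc k) ` sign_space e = (*v) T ` (*s) (c ^ k) ` ((*v) y ^^ k) ` (*v) S ` sign_space e"
    by (simp add: image_image del: funpow.simps)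
  moreover have "vec.subspace (((*v) y ^^ k) ` (*v) S ` sign_space e)"
    unfolding matrix_pow_vec[symmetric] by (intro vec_subspace_image subspace_sign_space)
  ultimately show ?thesis
    using ST(2) by (simp add: image_scale_subspace)
qed

text \<open>The element \<open>z = T S\<close> is the image of a point of \<open>W\<close> under \<open>\<phi>\<close> and \<open>S T\<close> is its image
  under \<open>\<psi>\<close>, up to transposition and a scalar.\<close>

lemma pow_dim_lift_le:
  assumes z: "z = T ** S" and ST: "\<And>v. S *v (T *v v) = c *s (transpose x *v v)" "c \<noteq> 0"
    and gr: "graded flip_sign S" "graded flip_sign x"
  shows "pow_dim z (Suc k) e \<le> pow_dim x k ((flip_sign ^^ Suc k) e)"
proof -
  have "pow_dim z (Suc k) e \<le> vec.dim (((*v) (transpose x) ^^ k) ` (*v) S ` sign_space e)"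
    unfolding pow_dim_def pow_dim_lift_image[OF z ST] by (rule vec_dim_image_le)
  also have "\<dots> \<le> pow_dim (transpose x) k (flip_sign e)"
    unfolding pow_dim_def using graded_image[OF gr(1)] by (intro vec.dim_subset image_mono) blast
  finally show ?thesis
    by (simp add: pow_dim_transpose[OF gr(2)] funpow_swap1)
qed

text \<open>A homogeneous surjection is surjective onto each piece: the component of a preimage in
  the wrong piece is sent into both pieces, hence to 0. With \<open>T\<close> injective no dimension
  is lost at either end.\<close>

lemma pow_dim_lift_eq:
  assumes z: "z = T ** S" and ST: "\<And>v. S *v (T *v v) = c *s (transpose x *v v)" "c \<noteq> 0"
    and gr: "graded flip_sign S" "graded flip_sign x"
    and inj: "inj ((*v) T)" and surj: "surj ((*v) S)"
  shows "pow_dim z (Suc k) e = pow_dim x k ((flip_sign ^^ Suc k) e)"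
proof -
  have "sign_space (flip_sign e) \<subseteq> (*v) S ` sign_space e"
  proof
    fix v :: "('c + 'd) cvec" assume v: "v \<in> sign_space (flip_sign e)"
    obtain u where u: "v = S *v u" using surj by (metis surjD)
    have eq: "S *v (sign_proj e *v u) + S *v (sign_proj (flip_sign e) *v u) = v"
      using sign_proj_add[of u] by (cases e) (auto simp: u add.commute simp flip: vec.add)
    have "S *v (sign_proj (flip_sign e) *v u) = v - S *v (sign_proj e *v u)"
      using eq by (simp add: algebra_simps)
    then have "S *v (sign_proj (flip_sign e) *v u) \<in> sign_space (flip_sign e)"
      using v graded_image[OF gr(1) sign_proj_in, of e u] subspace_sign_space
      by (metis vec.subspace_diff)
    moreover have "S *v (sign_proj (flip_sign e) *v u) \<in> sign_space e"
      using graded_image[OF gr(1) sign_proj_in, of "flip_sign e" u] by simp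
    ultimately have "v = S *v (sign_proj e *v u)"
      using eq sign_space_Int by fastforce
    then show "v \<in> (*v) S ` sign_space e" using sign_proj_in by blast
  qed
  then have "(*v) S ` sign_space e = sign_space (flip_sign e)"
    using graded_image[OF gr(1)] by blast
  then have "pow_dim z (Suc k) e = pow_dim (transpose x) k (flip_sign e)"
    unfolding pow_dim_def pow_dim_lift_image[OF z ST] by (simp add: vec_dim_image_inj[OF inj])
  then show ?thesis
    by (simp add: pow_dim_transpose[OF gr(2)] funpow_swap1)
qed

section \<open>Jordan bases\<close>

lemma flip_sign_eq_iff [simp]: "flip_sign d = flip_sign e \<longleftrightarrow> d = e"
  by (metis flip_sign_flip_sign)

lemma set_string_of: "set (string_of x (v, k)) = (\<lambda>j. ((*v) x ^^ j) v) ` {..<k}"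
  by (auto simp: string_of_def)

lemma length_string_of [simp]: "length (string_of x (v, k)) = k"
  by (simp add: string_of_def)

lemma string_of_Suc: "string_of x (v, Suc k) = v # string_of x (x *v v, k)"
  by (simp add: string_of_def upt_conv_Cons map_Suc_upt[symmetric] funpow_swap1 comp_def
      del: upt_Suc funpow.simps)
    (simp add: funpow_swap1)

lemma length_concat_string_of: "length (concat (map (string_of x) S)) = sum_list (map snd S)"
  by (induction S) auto

text \<open>A spanning list whose length is the dimension has no room for repetitions or relations.
  Hence the construction of Jordan strings needs to keep track of span and length only.\<close>

lemma spanning_list_basis:
  assumes "vec.span (set B) = U" "length B = vec.dim U"
  shows "distinct B" "vec.independent (set B)"
proof -
  have "vec.dim U \<le> card (set B)"
    using vec.dim_le_card[of U "set B"] assms(1) by simp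
  then have card: "card (set B) = length B"
    using card_length[of B] assms(2) by linarith
  then show "distinct B" by (rule card_distinct)
  show "vec.independent (set B)"
    using vec.card_le_dim_spanning[of "set B" U] assms card vec.span_superset by auto
qed

text \<open>Applied to the last vectors of strings, this makes their number the number of
  strings.\<close>

lemma distinct_lasts:
  assumes "distinct (concat (map f S))" "\<And>s. s \<in> set S \<Longrightarrow> f s \<noteq> []"
  shows "distinct (map (\<lambda>s. last (f s)) S)"
  using assms
proof (induction S)
  case (Cons s S)
  have "last (f s) \<noteq> last (f t)" if "t \<in> set S" for t
  proof
    assume "last (f s) = last (f t)"
    then have "last (f s) \<in> set (f s) \<inter> set (f t)"
      using Cons.prems(2)[of t] Cons.prems(2)[of s] that by (metis IntI last_in_set list.set_intros)
    then show False using Cons.prems(1) that by auto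
  qed
  then have "last (f s) \<notin> set (map (\<lambda>s. last (f s)) S)" by auto
  moreover have "distinct (map (\<lambda>s. last (f s)) S)" using Cons by simp
  ultimately show ?case by simp
qed simp

text \<open>Lift the strings of a Jordan basis of \<open>z U\<close> by one step and complete their last vectors,
  which are independent in the kernel, to a homogeneous basis of the kernel of \<open>z\<close> in \<open>U\<close>.\<close>

lemma graded_jordan_strings:
  fixes z :: "('a::finite + 'b::finite, 'a + 'b) cmat"
  assumes z: "graded flip_sign z"
  shows "vec.subspace U \<Longrightarrow> (\<And>u e. u \<in> U \<Longrightarrow> sign_proj e *v u \<in> U) \<Longrightarrow> (\<And>u. u \<in> U \<Longrightarrow> z *v u \<in> U) \<Longrightarrow>
    (\<And>u. u \<in> U \<Longrightarrow> ((*v) z ^^ N) u = 0) \<Longrightarrow>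
    \<exists>S. (\<forall>(v, k)\<in>set S. k \<ge> 1 \<and> ((*v) z ^^ k) v = 0 \<and> v \<in> U \<and> v \<in> sign_space Pos \<union> sign_space Neg) \<and>
      vec.span (set (concat (map (string_of z) S))) = U \<and>
      length (concat (map (string_of z) S)) = vec.dim U"
proof (induction N arbitrary: U)
  case 0
  then have "U = {0}" using vec.subspace_0[of U] by auto
  then show ?case by (intro exI[of _ "[]"]) simp
next
  case (Suc N)
  let ?H = "sign_space Pos \<union> sign_space Neg :: ('a + 'b) cvec set"
  define U1 where "U1 = (*v) z ` U"
  have proj: "sign_proj e *v (z *v u) = z *v (sign_proj (flip_sign e) *v u)" for e u
    using graded_sign_proj[OF z, of "flip_sign e"] by (simp add: matrix_vector_mul_assoc inj_def)
  have U1: "vec.subspace U1" "\<And>u e. u \<in> U1 \<Longrightarrow> sign_proj e *v u \<in> U1" "\<And>u. u \<in> U1 \<Longrightarrow> z *v u \<in> U1"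
    "\<And>u. u \<in> U1 \<Longrightarrow> ((*v) z ^^ N) u = 0" "U1 \<subseteq> U"
    using Suc.prems by (auto simp: U1_def proj vec_subspace_image funpow_swap1)
  obtain S1 where S1: "\<And>v k. (v, k) \<in> set S1 \<Longrightarrow> k \<ge> 1 \<and> ((*v) z ^^ k) v = 0 \<and> v \<in> U1 \<and> v \<in> ?H"
    and span1: "vec.span (set (concat (map (string_of z) S1))) = U1"
    and len1: "length (concat (map (string_of z) S1)) = vec.dim U1"
    using Suc.IH[OF U1(1-4)] by auto
  note ind1 = spanning_list_basis[OF span1 len1]
  have "\<exists>u. u \<in> U \<and> u \<in> ?H \<and> z *v u = v" if vk: "(v, k) \<in> set S1" for v k
  proof -
    obtain u0 where u0: "u0 \<in> U" "v = z *v u0" using S1[OF vk] by (auto simp: U1_def)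
    obtain e where e: "v \<in> sign_space e" using S1[OF vk] by auto
    \<comment> \<open>An arbitrary preimage of the homogeneous vector \<open>v\<close> may be
      replaced by its component of the opposite sign, because \<open>z\<close> has degree
      one.\<close>
    have "v = sign_proj e *v v"
      using e by (auto simp: vec_eq_iff sign_proj_vec sign_space_def)
    then have "z *v (sign_proj (flip_sign e) *v u0) = v" using proj u0(2) by metis
    moreover have "sign_proj (flip_sign e) *v u0 \<in> ?H"
      using sign_proj_in[of "flip_sign e" u0] by (cases e) auto
    ultimately show ?thesis using Suc.prems(2)[OF u0(1)] by blast
  qed
  then obtain g where g: "\<And>v k. (v, k) \<in> set S1 \<Longrightarrow> g v \<in> U \<and> g v \<in> ?H \<and> z *v g v = v"
    by metis
  define S1' where "S1' = map (\<lambda>(v, k). (g v, Suc k)) S1"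
  define B1 where "B1 = concat (map (string_of z) S1)"
  define B1' where "B1' = concat (map (string_of z) S1')"
  have set_B1: "set B1 = (\<Union>(v, k)\<in>set S1. (\<lambda>j. ((*v) z ^^ j) v) ` {..<k})"
    by (auto simp: B1_def set_string_of)
  have "string_of z (g v, Suc k) = g v # string_of z (v, k)" if "(v, k) \<in> set S1" for v k
    using g[OF that] by (simp add: string_of_Suc)
  then have set_B1': "set B1' = (\<Union>(v, k)\<in>set S1. insert (g v) (set (string_of z (v, k))))"
    by (force simp: B1'_def S1'_def)
  have B1_sub: "set B1 \<subseteq> set B1'" by (auto simp: set_B1' B1_def)
  have B1U: "set B1 \<subseteq> U1" unfolding B1_def span1[symmetric] by (rule vec.span_superset)
  have B1'_U: "set B1' \<subseteq> U"
  proof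
    fix b assume "b \<in> set B1'"
    then obtain v k where vk: "(v, k) \<in> set S1" "b = g v \<or> b \<in> set (string_of z (v, k))"
      unfolding set_B1' by blast
    moreover have "set (string_of z (v, k)) \<subseteq> set B1" using vk(1) by (auto simp: B1_def)
    ultimately show "b \<in> U" using g B1U U1(5) by blast
  qed
  have len_B1': "length B1' = length S1 + vec.dim U1"
    unfolding B1'_def length_concat_string_of len1[symmetric]
    by (simp add: S1'_def case_prod_beta' comp_def sum_list_Suc)
  let ?K = "{u \<in> U. z *v u = 0}"
  have K: "vec.subspace ?K" by (rule vec_subspace_kernel[OF Suc.prems(1)])
  define L where "L = map (\<lambda>s. last (string_of z s)) S1"
  have ne: "string_of z s \<noteq> []" if "s \<in> set S1" for s
    using S1[of "fst s" "snd s"] that by (cases s) (auto simp: string_of_def)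
  have "distinct L"
    unfolding L_def by (rule distinct_lasts[OF ind1(1) ne])
  have L_B1: "set L \<subseteq> set B1"
    using last_in_set[OF ne] unfolding L_def B1_def set_map set_concat by blast
  have indL: "vec.independent (set L)"
    using ind1(2) L_B1 vec.independent_mono unfolding B1_def by blast
  have string_H: "((*v) z ^^ j) v \<in> ?H" if "v \<in> ?H" for j v
  proof (induction j)
    case (Suc j)
    then show ?case using graded_image[OF z, of "((*v) z ^^ j) v" Pos]
      graded_image[OF z, of "((*v) z ^^ j) v" Neg] by auto
  qed (use that in simp)
  have LKH: "set L \<subseteq> ?K \<inter> ?H"
  proof
    fix l assume "l \<in> set L"
    then obtain v k where vk: "(v, k) \<in> set S1" "l = last (string_of z (v, k))" by (auto simp: L_def)
    obtain k' where k': "k = Suc k'" using S1[OF vk(1)] by (cases k) auto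
    have l: "l = ((*v) z ^^ k') v" by (simp add: vk(2) k' string_of_def)
    have "z *v l = 0" using S1[OF vk(1)] by (simp add: l k')
    moreover have "l \<in> U" using \<open>l \<in> set L\<close> L_B1 B1U U1(5) by blast
    moreover have "l \<in> ?H" using string_H S1[OF vk(1)] l by blast
    ultimately show "l \<in> ?K \<inter> ?H" by simp
  qed
  obtain E where E: "set L \<subseteq> E" "E \<subseteq> ?K \<inter> ?H" "vec.independent E" "?K \<inter> ?H \<subseteq> vec.span E"
    using vec.maximal_independent_subset_extend[OF LKH indL] .
  have "?K \<subseteq> vec.span E"
  proof
    fix u assume u: "u \<in> ?K"
    have "sign_proj e *v u \<in> ?K \<inter> ?H" for e
    proof -
      have "sign_proj (flip_sign e) *v (z *v u) = z *v (sign_proj e *v u)"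
        using proj[of "flip_sign e" u] by simp
      then have "z *v (sign_proj e *v u) = 0" using u by simp
      then show ?thesis using u Suc.prems(2)[of u e] sign_proj_in[of e u] by (cases e) auto
    qed
    then have "sign_proj Pos *v u + sign_proj Neg *v u \<in> vec.span E"
      using E(4) by (intro vec.span_add) blast+
    then show "u \<in> vec.span E" by (simp add: sign_proj_add)
  qed
  moreover have "vec.span E \<subseteq> ?K" using E(2) K by (intro vec.span_minimal) auto
  ultimately have spanE: "vec.span E = ?K" by blast
  have finE: "finite E" using E(3) by (rule vec.finiteI_independent)
  have cardE: "card E = vec.dim ?K"
    using vec.dim_span_eq_card_independent[OF E(3)] spanE by simp
  obtain W where W: "set W = E - set L" "distinct W" using finE finite_distinct_list[of "E - set L"] by auto
  \<comment> \<open>Each element of the basis \<open>E\<close> of the kernel ends exactly one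
    string: those in \<open>L\<close> end the lifted strings, the others form strings of length
    one.\<close>
  have lenW: "length W + length S1 = vec.dim ?K"
  proof -
    have "card (set L) = length S1" using distinct_card[OF \<open>distinct L\<close>] by (simp add: L_def)
    then show ?thesis
      using card_Diff_subset[of "set L" E] E(1) finE distinct_card[OF W(2)] W(1)
        card_mono[OF finE E(1)] cardE by simp
  qed
  define S where "S = S1' @ map (\<lambda>w. (w, 1)) W"
  define B where "B = concat (map (string_of z) S)"
  have "concat (map (string_of z) (map (\<lambda>w. (w, 1)) W)) = W"
    by (induction W) (simp_all add: string_of_def)
  then have B: "B = B1' @ W" by (simp add: B_def S_def B1'_def)
  have lenB: "length B = vec.dim U1 + vec.dim ?K"
    using lenW len_B1' by (simp add: B)
  have span_sub: "vec.span (set B) \<subseteq> U"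
    using B1'_U E(2) W(1) Suc.prems(1) by (intro vec.span_minimal) (auto simp: B)
  have "U \<subseteq> vec.span (set B)"
  proof
    fix u assume u: "u \<in> U"
    have "set B1 \<subseteq> (*v) z ` set B1'"
    proof
      fix b assume "b \<in> set B1"
      then obtain v k j where b: "(v, k) \<in> set S1" "j < k" "b = ((*v) z ^^ j) v"
        by (auto simp: set_B1)
      show "b \<in> (*v) z ` set B1'"
      proof (cases j)
        case 0
        then have "b = z *v g v" using b g by simp
        moreover have "g v \<in> set B1'" using b(1) by (auto simp: set_B1')
        ultimately show ?thesis by blast
      next
        case (Suc i)
        then have "b = z *v ((*v) z ^^ i) v" using b by simp
        moreover have "((*v) z ^^ i) v \<in> set B1"
          using b Suc by (auto simp: set_B1 intro!: bexI[of _ "(v, k)"])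
        ultimately show ?thesis using B1_sub by blast
      qed
    qed
    then have "vec.span (set B1) \<subseteq> (*v) z ` vec.span (set B1')"
      by (metis vec.span_image vec.span_mono)
    moreover have "z *v u \<in> vec.span (set B1)" using u span1 by (auto simp: B1_def U1_def)
    ultimately obtain y where y: "y \<in> vec.span (set B1')" "z *v u = z *v y" by blast
    have yB: "y \<in> vec.span (set B)" using y(1) vec.span_mono[of "set B1'" "set B"] by (auto simp: B)
    have "u - y \<in> ?K"
      using u y yB span_sub Suc.prems(1) by (auto simp: vec.subspace_diff algebra_simps)
    then have "u - y \<in> vec.span E" by (simp add: spanE)
    moreover have "E \<subseteq> set B" using W(1) L_B1 B1_sub by (auto simp: B)
    ultimately have "u - y \<in> vec.span (set B)" using vec.span_mono by blast
    then have "(u - y) + y \<in> vec.span (set B)" using yB by (rule vec.span_add)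
    then show "u \<in> vec.span (set B)" by simp
  qed
  with span_sub have spanB: "vec.span (set B) = U" by blast
  \<comment> \<open>Spanning gives at least \<open>vec.dim U\<close> vectors, while the count by
    image and kernel gives at most that many.\<close>
  have "vec.dim U \<le> length B"
    using vec.dim_le_card[of U "set B"] spanB card_length[of B] by simp
  then have lenB': "length B = vec.dim U"
    using lenB vec_rank_nullity_le[OF Suc.prems(1), of z] by (simp add: U1_def)
  have "k \<ge> 1 \<and> ((*v) z ^^ k) v = 0 \<and> v \<in> U \<and> v \<in> ?H" if vk: "(v, k) \<in> set S" for v k
  proof (cases "(v, k) \<in> set S1'")
    case True
    then obtain v' k' where v': "(v', k') \<in> set S1" "v = g v'" "k = Suc k'" by (auto simp: S1'_def)
    have "((*v) z ^^ k) v = ((*v) z ^^ k') v'"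
      using g[OF v'(1)] by (simp add: v' funpow_swap1)
    then show ?thesis using g[OF v'(1)] S1[OF v'(1)] v'(2,3) by simp
  next
    case False
    then have "v \<in> E" "k = 1" using vk W(1) by (auto simp: S_def)
    then show ?thesis using E(2) by auto
  qed
  then show ?case
    using spanB lenB' by (intro exI[of _ S]) (auto simp: B_def)
qed

lemma string_of_homogeneous:
  fixes z :: "('a::finite + 'b::finite, 'a + 'b) cmat"
  assumes z: "graded flip_sign z" and v: "v \<in> sign_space e"
  shows "((*v) z ^^ j) v \<in> sign_space ((flip_sign ^^ j) e)"
  by (induction j) (use v graded_image[OF z] in auto)

lemma sign_spaces_eq: "V_plus \<union> V_minus = (\<Union>e. sign_space e)"
  by (auto simp: V_plus_eq V_minus_eq) (metis (full_types) sign.exhaust)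

lemma ex_signed_jordan_basis:
  fixes z :: "('a::finite + 'b::finite, 'a + 'b) cmat"
  assumes z: "graded flip_sign z" and nil: "\<And>v. ((*v) z ^^ N) v = 0"
  shows "\<exists>S. signed_jordan_basis z S"
proof -
  obtain S where S: "\<And>v k. (v, k) \<in> set S \<Longrightarrow>
      k \<ge> 1 \<and> ((*v) z ^^ k) v = 0 \<and> v \<in> sign_space Pos \<union> sign_space Neg"
    and span: "vec.span (set (concat (map (string_of z) S))) = UNIV"
    and len: "length (concat (map (string_of z) S)) = vec.dim (UNIV :: ('a + 'b) cvec set)"
    using graded_jordan_strings[OF z vec.subspace_UNIV UNIV_I UNIV_I nil] by blast
  have "set (string_of z (v, k)) \<subseteq> V_plus \<union> V_minus" if "(v, k) \<in> set S" for v k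
    using S[OF that] string_of_homogeneous[OF z] by (auto simp: sign_spaces_eq set_string_of)
  then show ?thesis
    using S span spanning_list_basis[OF span len]
    by (intro exI[of _ S]) (auto simp: signed_jordan_basis_def Let_def)
qed

section \<open>Dimensions read off the rows of a Jordan basis\<close>

lemma mset_drop_subseteq: "mset (drop j xs) \<subseteq># mset xs"
  by (metis append_take_drop_id mset_append mset_subset_eq_add_right)

lemma mset_concat_map_subseteq:
  assumes "\<And>s. s \<in> set S \<Longrightarrow> mset (f s) \<subseteq># mset (g s)"
  shows "mset (concat (map f S)) \<subseteq># mset (concat (map g S))"
  using assms by (induction S) (auto intro: subset_mset.add_mono)

lemma mset_subseteq_distinct:
  assumes "mset xs \<subseteq># mset ys" "distinct ys"
  shows "distinct xs" "set xs \<subseteq> set ys"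
proof -
  show "set xs \<subseteq> set ys" using set_mset_mono[OF assms(1)] by simp
  have "count (mset xs) a \<le> 1" for a
    using mset_subset_eqD assms mset_subset_eq_count[OF assms(1), of a]
    by (metis One_nat_def distinct_count_atmost_1 le_trans count_mset le_numeral_extra(4) bot_nat_0.extremum)
  then show "distinct xs"
    by (metis count_greater_zero_iff distinct_count_atmost_1 le_antisym less_one not_less not_gr_zero set_mset_mset)
qed

text \<open>The \<open>j\<close>-th power moves each string along itself. A member of index
  \<open>i\<close> survives exactly when \<open>i + j < k\<close>, and the surviving images are
  again basis vectors, so the rank counts the members of sign \<open>e\<close> among the first
  \<open>k - j\<close>.\<close>

lemma pow_dim_signed_jordan_basis:
  assumes x: "graded flip_sign x" and S: "signed_jordan_basis x S"
  shows "pow_dim x j e = (\<Sum>(v, k)\<leftarrow>S. count_list (take (k - j) (map vec_sign (string_of x (v, k)))) e)"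
proof -
  let ?f = "(*v) x"
  define B where "B = concat (map (string_of x) S)"
  have Sd: "k \<ge> 1 \<and> (?f ^^ k) v = 0 \<and> set (string_of x (v, k)) \<subseteq> V_plus \<union> V_minus"
    if "(v, k) \<in> set S" for v k
    using S that by (auto simp: signed_jordan_basis_def)
  have B: "distinct B" "vec.independent (set B)" "vec.span (set B) = UNIV"
    using S by (simp_all add: signed_jordan_basis_def B_def Let_def)
  have set_B: "set B = (\<Union>(v, k)\<in>set S. (\<lambda>j. (?f ^^ j) v) ` {..<k})"
    by (auto simp: B_def set_string_of)
  have hom: "b \<in> sign_space (vec_sign b)" if "b \<in> set B" for b
    using that Sd vec_sign_space by (fastforce simp: B_def)
  define Be where "Be d = {b \<in> set B. vec_sign b = d}" for d
  have Be: "vec.span (Be d) \<subseteq> sign_space d" for d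
    using hom by (intro vec.span_minimal subspace_sign_space) (auto simp: Be_def)
  \<comment> \<open>All basis vectors are homogeneous. In an expansion of a vector of sign
    \<open>e\<close>, the part of the other sign lies in both pieces and vanishes.\<close>
  have space: "sign_space e = vec.span (Be e)"
  proof
    show "sign_space e \<subseteq> vec.span (Be e)"
    proof
      fix v :: "('a + 'b) cvec" assume v: "v \<in> sign_space e"
      have "set B = Be e \<union> Be (flip_sign e)"
        by (auto simp: Be_def neq_flip_sign)
      then have "v \<in> vec.span (Be e \<union> Be (flip_sign e))" using B(3) by simp
      then obtain a b where ab: "v = a + b" "a \<in> vec.span (Be e)" "b \<in> vec.span (Be (flip_sign e))"
        by (auto simp: vec.span_Un)
      have "b = v - a" by (simp add: ab(1))
      then have "b \<in> sign_space e"
        using v ab(2) Be subspace_sign_space by (metis subsetD vec.subspace_diff)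
      then have "b = 0" using sign_space_Int Be ab(3) by blast
      then show "v \<in> vec.span (Be e)" using ab by simp
    qed
  qed (rule Be)
  \<comment> \<open>The images are kept as lists taken from the strings, so that they inherit
    distinctness from \<open>B\<close> by inclusion of multisets.\<close>
  define P where "P = (\<lambda>(v, k). map (\<lambda>i. (?f ^^ (i + j)) v) (filter (\<lambda>i. vec_sign ((?f ^^ i) v) = e) [0..<k - j]))"
  define L where "L = concat (map P S)"
  have "mset (P s) \<subseteq># mset (string_of x s)" for s
  proof (cases s)
    case (Pair v k)
    have "drop j (string_of x s) = map (\<lambda>i. (?f ^^ (i + j)) v) [0..<k - j]"
      by (rule nth_equalityI) (auto simp: Pair string_of_def add.commute)
    moreover have "mset (P s) \<subseteq># mset (map (\<lambda>i. (?f ^^ (i + j)) v) [0..<k - j])"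
      by (simp only: P_def Pair prod.case mset_map mset_filter)
        (intro image_mset_subseteq_mono multiset_filter_subset)
    ultimately show ?thesis using mset_drop_subseteq by (metis subset_mset.order_trans)
  qed
  then have "mset L \<subseteq># mset B" unfolding L_def B_def by (intro mset_concat_map_subseteq)
  note L = mset_subseteq_distinct[OF this B(1)]
  have set_L: "set L = {(?f ^^ (i + j)) v | v k i. (v, k) \<in> set S \<and> i + j < k \<and> vec_sign ((?f ^^ i) v) = e}"
    by (force simp: L_def P_def)
  have sub1: "set L \<subseteq> (?f ^^ j) ` Be e"
  proof
    fix b assume "b \<in> set L"
    then obtain v k i where b: "b = (?f ^^ (i + j)) v" "(v, k) \<in> set S" "i + j < k"
      "vec_sign ((?f ^^ i) v) = e" by (auto simp: set_L)
    have "b = (?f ^^ j) ((?f ^^ i) v)" by (simp add: b(1) add.commute[of i] funpow_add)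
    moreover have "(?f ^^ i) v \<in> Be e"
      using b(2-4) by (auto simp: Be_def set_B intro!: bexI[of _ "(v, k)"])
    ultimately show "b \<in> (?f ^^ j) ` Be e" by blast
  qed
  have sub2: "(?f ^^ j) ` Be e \<subseteq> insert 0 (set L)"
  proof
    fix b assume "b \<in> (?f ^^ j) ` Be e"
    then obtain v k i where b: "b = (?f ^^ j) ((?f ^^ i) v)" "(v, k) \<in> set S" "i < k"
      "vec_sign ((?f ^^ i) v) = e" by (auto simp: Be_def set_B)
    have b': "b = (?f ^^ (i + j)) v" by (simp add: b(1) add.commute[of i] funpow_add)
    show "b \<in> insert 0 (set L)"
    proof (cases "i + j < k")
      case True
      then have "b \<in> set L" unfolding set_L using b(2,4) b' by blast
      then show ?thesis by simp
    next
      case False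
      then obtain l where "i + j = l + k" by (metis add.commute le_Suc_ex not_less)
      then have "b = (?f ^^ l) 0" using b' Sd[OF b(2)] by (simp add: funpow_add)
      also have "\<dots> = 0" by (induction l) auto
      finally show ?thesis by simp
    qed
  qed
  have "vec.span ((?f ^^ j) ` Be e) = vec.span (set L)"
    using vec.span_mono[OF sub1] vec.span_mono[OF sub2] by (simp add: vec.span_insert_0)
  moreover have "(?f ^^ j) ` sign_space e = vec.span ((?f ^^ j) ` Be e)"
    unfolding space matrix_pow_vec[symmetric] by (rule vec.span_image[symmetric])
  ultimately have "pow_dim x j e = vec.dim (vec.span (set L))" by (simp add: pow_dim_def)
  also have "\<dots> = length L"
    using vec.dim_span_eq_card_independent[OF vec.independent_mono[OF B(2) L(2)]]
      distinct_card[OF L(1)] by simp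
  also have "\<dots> = (\<Sum>s\<leftarrow>S. length (P s))" by (simp add: L_def length_concat comp_def)
  also have "\<dots> = (\<Sum>(v, k)\<leftarrow>S. count_list (take (k - j) (map vec_sign (string_of x (v, k)))) e)"
  proof -
    have "length (P s) = (case s of (v, k) \<Rightarrow> count_list (take (k - j) (map vec_sign (string_of x (v, k)))) e)" for s
    proof (cases s)
      case (Pair v k)
      have "take (k - j) (map vec_sign (string_of x (v, k))) = map (\<lambda>i. vec_sign ((?f ^^ i) v)) [0..<k - j]"
        by (rule nth_equalityI) (auto simp: string_of_def)
      then show ?thesis
        by (simp add: Pair P_def count_list_eq_length_filter filter_map comp_def eq_commute[of e])
    qed
    then show ?thesis by simp
  qed
  finally show ?thesis .
qed

text \<open>\<open>vec_sign\<close> is meaningful for nonzero homogeneous vectors only, as 0 lies in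
  both pieces. Independence excludes 0 from the strings, and then the degree of \<open>x\<close>
  forces alternation.\<close>

lemma signed_jordan_basis_row:
  assumes x: "graded flip_sign x" and S: "signed_jordan_basis x S" and s: "s \<in> set S"
  shows "map vec_sign (string_of x s) \<noteq> []" "distinct_adj (map vec_sign (string_of x s))"
proof -
  obtain v k where vk: "s = (v, k)" by (cases s)
  have k: "k \<ge> 1" and hom: "set (string_of x s) \<subseteq> V_plus \<union> V_minus"
    and ind: "vec.independent (set (concat (map (string_of x) S)))"
    using S s by (auto simp: signed_jordan_basis_def vk Let_def)
  then show "map vec_sign (string_of x s) \<noteq> []" by (simp add: vk string_of_def)
  have nz: "((*v) x ^^ i) v \<noteq> 0" if "i < k" for i
  proof -
    have "((*v) x ^^ i) v \<in> set (concat (map (string_of x) S))"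
      using s that by (force simp: vk set_string_of)
    then show ?thesis using ind vec.dependent_zero by metis
  qed
  show "distinct_adj (map vec_sign (string_of x s))"
  proof (simp add: distinct_adj_conv_nth vk, intro allI impI)
    fix i assume i: "Suc i < k"
    have "((*v) x ^^ i) v \<in> V_plus \<union> V_minus" using hom i by (simp add: vk set_string_of image_subset_iff)
    then have "((*v) x ^^ Suc i) v \<in> sign_space (flip_sign (vec_sign (((*v) x ^^ i) v)))"
      using graded_image[OF x vec_sign_space] by simp
    then have "vec_sign (((*v) x ^^ Suc i) v) = flip_sign (vec_sign (((*v) x ^^ i) v))"
      using vec_sign_eq nz[OF i] by blast
    then show "vec_sign (string_of x (v, k) ! i) \<noteq> vec_sign (string_of x (v, k) ! Suc i)"
      using i by (simp add: string_of_def)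
  qed
qed

lemma full_diagram'_pow_dim:
  assumes "graded flip_sign x" "full_diagram' x D"
  shows "pow_dim x j e = (\<Sum>r\<in>#D. count_list (take (length r - j) r) e)"
    and "signed_young_diagram D"
proof -
  obtain S where S: "signed_jordan_basis x S" "D = mset (map (\<lambda>vk. map vec_sign (string_of x vk)) S)"
    using assms(2) by (auto simp: full_diagram'_def)
  show "pow_dim x j e = (\<Sum>r\<in>#D. count_list (take (length r - j) r) e)"
    unfolding pow_dim_signed_jordan_basis[OF assms(1) S(1)] S(2)
    by (auto simp: sum_mset_sum_list comp_def simp flip: mset_map intro!: arg_cong[of _ _ sum_list] map_cong)
  show "signed_young_diagram D"
    using signed_jordan_basis_row[OF assms(1) S(1)] by (auto simp: signed_young_diagram_def S(2))
qed

lemma full_diagram_iff: "full_diagram z D \<longleftrightarrow> full_diagram' z (image_mset rev D)"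
proof -
  have "D = mset (map (\<lambda>vk. rev (map vec_sign (string_of z vk))) S) \<longleftrightarrow>
      image_mset rev D = mset (map (\<lambda>vk. map vec_sign (string_of z vk)) S)" for S
  proof
    assume "image_mset rev D = mset (map (\<lambda>vk. map vec_sign (string_of z vk)) S)"
    then have "image_mset rev (image_mset rev D) = image_mset rev (mset (map (\<lambda>vk. map vec_sign (string_of z vk)) S))"
      by simp
    then show "D = mset (map (\<lambda>vk. rev (map vec_sign (string_of z vk))) S)"
      by (simp add: image_mset.compositionality comp_def)
  qed (simp add: image_mset.compositionality comp_def)
  then show ?thesis by (simp only: full_diagram_def full_diagram'_def)
qed

text \<open>As rows for \<open>G\<close> are written backwards, the surviving first members of a
  string are the boxes left after dropping \<open>j\<close> from the front of the row.\<close>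

lemma full_diagram_pow_dim:
  assumes "graded flip_sign z" "full_diagram z D"
  shows "pow_dim z j e = (\<Sum>r\<in>#D. count_list (drop j r) e)"
    and "signed_young_diagram D"
proof -
  have D: "full_diagram' z (image_mset rev D)" using assms(2) by (simp add: full_diagram_iff)
  have "count_list (take (length r - j) (rev r)) e = count_list (drop j r) e" for r
    by (metis count_list_rev length_rev rev_drop)
  then show "pow_dim z j e = (\<Sum>r\<in>#D. count_list (drop j r) e)"
    using full_diagram'_pow_dim(1)[OF assms(1) D, of j e]
    by (simp add: image_mset.compositionality comp_def)
  show "signed_young_diagram D"
    using full_diagram'_pow_dim(2)[OF assms(1) D] by (auto simp: signed_young_diagram_def)
qed

text \<open>Nilpotency is assumed as vanishing of ranks, the form in which \<open>z\<close> inherits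
  it from \<open>x\<close>.\<close>

lemma ex_full_diagram:
  assumes z: "graded flip_sign z" and nil: "\<And>e. pow_dim z N e = 0"
  shows "\<exists>D. full_diagram z D"
proof -
  have zero: "((*v) z ^^ N) v = 0" if "v \<in> sign_space e" for v e
  proof -
    have "((*v) z ^^ N) ` sign_space e \<subseteq> {0}"
      using nil[of e] by (simp only: pow_dim_def vec.dim_eq_0)
    then show ?thesis using that by blast
  qed
  have "((*v) z ^^ N) v = 0" for v
  proof -
    have "((*v) z ^^ N) v = matrix_pow z N *v (sign_proj Pos *v v + sign_proj Neg *v v)"
      by (simp add: sign_proj_add matrix_pow_vec)
    also have "\<dots> = 0"
      by (simp add: vec.add matrix_pow_vec zero[OF sign_proj_in])
    finally show ?thesis .
  qed
  then obtain S where "signed_jordan_basis z S"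
    using ex_signed_jordan_basis[OF z] by blast
  then show ?thesis by (auto simp: full_diagram_def)
qed

section \<open>Signed rows\<close>

fun alternating :: "sign \<Rightarrow> nat \<Rightarrow> row"
  where
    "alternating s 0 = []"
  | "alternating s (Suc n) = s # alternating (flip_sign s) n"

lemma length_alternating [simp]: "length (alternating s n) = n"
  by (induction n arbitrary: s) auto

lemma alternating_eq_Nil [simp]: "alternating s n = [] \<longleftrightarrow> n = 0"
  by (cases n) auto

lemma hd_alternating: "n > 0 \<Longrightarrow> hd (alternating s n) = s"
  by (cases n) auto

lemma distinct_adj_alternating: "distinct_adj (alternating s n)"
  by (induction n arbitrary: s) (auto simp: distinct_adj_Cons hd_alternating)

lemma alternating_hd_length: "distinct_adj r \<Longrightarrow> r = alternating (hd r) (length r)"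
proof (induction r)
  case (Cons s r)
  then show ?case by (cases r) (auto simp: neq_flip_sign)
qed simp

lemma alternating_cases:
  assumes "distinct_adj r"
  obtains s where "r = alternating s (length r)"
  using alternating_hd_length[OF assms] by blast

lemma take_alternating: "take m (alternating s n) = alternating s (min m n)"
  by (induction n arbitrary: s m) (auto simp: take_Cons split: nat.splits)

lemma drop_alternating: "drop k (alternating s n) = alternating ((flip_sign ^^ k) s) (n - k)"
  by (induction n arbitrary: s k) (auto simp: drop_Cons funpow_swap1 split: nat.splits)

lemma butlast_alternating: "butlast (alternating s n) = alternating s (n - 1)"
  by (simp add: butlast_conv_take take_alternating)

lemma map_flip_sign_alternating: "map flip_sign (alternating s n) = alternating (flip_sign s) n"
  by (induction n arbitrary: s) auto

lemma flip_sign_comp_flip_sign [simp]: "flip_sign \<circ> flip_sign = id"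
  by auto

lemma alternating_Suc_snoc: "alternating s (Suc n) = alternating s n @ [(flip_sign ^^ n) s]"
proof (induction n arbitrary: s)
  case (Suc n)
  show ?case
    by (subst alternating.simps(2), subst Suc) (simp add: funpow_swap1)
qed simp

lemma count_list_map_flip_sign: "count_list (map flip_sign r) (flip_sign e) = count_list r e"
  by (induction r) auto

lemma count_list_alternating_flip:
  "count_list (alternating (flip_sign s) n) e = count_list (alternating s n) (flip_sign e)"
  using count_list_map_flip_sign[of "alternating s n" "flip_sign e"]
  by (simp add: map_flip_sign_alternating)

lemma count_list_alternating_flip_pow:
  "count_list (alternating ((flip_sign ^^ k) s) n) e = count_list (alternating s n) ((flip_sign ^^ k) e)"
proof (induction k arbitrary: e)
  case (Suc k)
  show ?case by (simp add: count_list_alternating_flip Suc) (simp add: funpow_swap1)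
qed simp

lemma count_list_alternating_even:
  assumes "even n"
  shows "count_list (alternating (flip_sign s) n) e = count_list (alternating s n) e"
proof -
  have "count_list (alternating (flip_sign s) (2 * m)) e = count_list (alternating s (2 * m)) e" for m
    by (induction m) (cases s; cases e; auto)+
  then show ?thesis using assms by (metis evenE)
qed

section \<open>Recovering the rows from the ranks\<close>

definition tail_count :: "nat \<Rightarrow> sign \<Rightarrow> row multiset \<Rightarrow> nat"
  where "tail_count j e D = (\<Sum>r\<in>#D. count_list (take (length r - j) r) e)"

definition long_rows :: "nat \<Rightarrow> sign \<Rightarrow> row multiset \<Rightarrow> row multiset"
  where "long_rows j e D = {#r \<in># D. j < length r \<and> hd r = e#}"

text \<open>\<open>tail_count j e D\<close> is \<open>pow_dim x j e\<close> for a diagram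
  \<open>D\<close> of \<open>x\<close>. In an alternating row, the signs after the first repeat the
  row shifted by one flip. So the two counts differ by one exactly when the row is longer than
  \<open>j\<close> and starts with \<open>e\<close>.\<close>

lemma tail_count_Suc:
  assumes "\<forall>r\<in>#D. distinct_adj r"
  shows "tail_count j e D = tail_count (Suc j) (flip_sign e) D + size (long_rows j e D)"
  using assms
proof (induction D)
  case (add r D)
  obtain s where r: "r = alternating s (length r)" using alternating_cases add.prems by auto
  have "count_list (take (length r - j) r) e =
      count_list (take (length r - Suc j) r) (flip_sign e) + (if j < length r \<and> hd r = e then 1 else 0)"
  proof (cases "length r - j")
    case (Suc m)
    then have "length r - Suc j = m" "m \<le> length r" "Suc m \<le> length r" "j < length r" by auto
    moreover have "hd r = s" using r hd_alternating calculation(4) by (metis less_nat_zero_code not_gr_zero)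
    ultimately show ?thesis
      using Suc by (subst (1 2) r) (auto simp: take_alternating count_list_alternating_flip min_def)
  qed auto
  then show ?case using add by (simp add: tail_count_def long_rows_def)
qed (simp add: tail_count_def long_rows_def)

lemma count_alternating:
  assumes "\<forall>r\<in>#D. distinct_adj r"
  shows "size (long_rows j e D) = size (long_rows (Suc j) e D) + count D (alternating e (Suc j))"
  using assms
proof (induction D)
  case (add r D)
  have "r = alternating e (Suc j) \<longleftrightarrow> length r = Suc j \<and> hd r = e"
    using add.prems alternating_hd_length[of r] by auto
  then show ?case using add by (auto simp: long_rows_def)
qed (simp add: long_rows_def)

text \<open>First differences of ranks count the rows longer than \<open>j\<close> with a given
  first sign, second differences those of length \<open>Suc j\<close>. Empty rows are invisible to
  all ranks.\<close>

lemma count_eq_if_tail_count_eq: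
  assumes D: "\<forall>r\<in>#D. distinct_adj r" and E: "\<forall>r\<in>#E. distinct_adj r"
    and eq: "\<And>j e. tail_count j e D = tail_count j e E" and r: "r \<noteq> []"
  shows "count D r = count E r"
proof (cases "distinct_adj r")
  case True
  then obtain s n where "r = alternating s (Suc n)"
    using r by (metis alternating_cases length_0_conv not0_implies_Suc)
  moreover have "size (long_rows j e D) = size (long_rows j e E)" for j e
    using tail_count_Suc[OF D, of j e] tail_count_Suc[OF E, of j e] eq by simp
  ultimately show ?thesis
    using count_alternating[OF D, of n s] count_alternating[OF E, of n s] by simp
next
  case False
  then have "r \<notin># D" "r \<notin># E" using D E by auto
  then show ?thesis by (simp add: not_in_iff)
qed

text \<open>The multiplicity of a row of length \<open>Suc j\<close> is a second difference
  involving the levels \<open>j\<close>, \<open>Suc j\<close> and \<open>Suc (Suc j)\<close>. The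
  middle level enters as a sum over both signs, so symmetry at even levels is enough.\<close>

lemma count_alternating_symmetric:
  assumes D: "\<forall>r\<in>#D. distinct_adj r"
    and eq: "\<And>j. even j \<Longrightarrow> tail_count j Pos D = tail_count j Neg D" and "odd n"
  shows "count D (alternating Pos n) = count D (alternating Neg n)"
proof -
  obtain j where j: "n = Suc j" "even j" using \<open>odd n\<close> by (cases n) auto
  have "tail_count (Suc (Suc j)) Pos D = tail_count (Suc (Suc j)) Neg D"
    using eq j by simp
  then show ?thesis
    using count_alternating[OF D, of j Pos] count_alternating[OF D, of j Neg]
      tail_count_Suc[OF D, of j Pos] tail_count_Suc[OF D, of j Neg]
      tail_count_Suc[OF D, of "Suc j" Pos] tail_count_Suc[OF D, of "Suc j" Neg] eq[OF j(2)] j(1)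
    by simp
qed

section \<open>Signatures and the addition of boxes\<close>

definition sign_count :: "sign \<Rightarrow> row multiset \<Rightarrow> nat"
  where "sign_count e D = (\<Sum>r\<in>#D. count_list r e)"

lemma signature_eq: "signature D = (sign_count Pos D, sign_count Neg D)"
  by (simp add: signature_def sign_count_def)

lemma sign_count_union [simp]: "sign_count e (A + B) = sign_count e A + sign_count e B"
  by (simp add: sign_count_def)

lemma sign_count_replicate [simp]:
  "sign_count e (replicate_mset a [s]) = (if s = e then a else 0)"
  by (induction a) (auto simp: sign_count_def)

lemma sign_count_image:
  assumes "\<And>r. r \<in># D \<Longrightarrow> count_list (f r) e = count_list r e"
  shows "sign_count e (image_mset f D) = sign_count e D"
  using assms by (induction D) (auto simp: sign_count_def)

text \<open>Alternation forces the new sign on a nonempty row. On the empty row \<open>last\<close>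
  is unspecified, so boxes added to empty rows are treated separately.\<close>

definition add_box :: "row \<Rightarrow> row"
  where "add_box r = r @ [flip_sign (last r)]"

lemma add_box_inj [simp]: "add_box r = add_box r' \<longleftrightarrow> r = r'"
  by (auto simp: add_box_def)

lemma length_add_box [simp]: "length (add_box r) = Suc (length r)"
  by (simp add: add_box_def)

lemma hd_add_box: "r \<noteq> [] \<Longrightarrow> hd (add_box r) = hd r"
  by (simp add: add_box_def)

lemma add_box_ne [simp]: "add_box r \<noteq> []"
  by (simp add: add_box_def)

lemma distinct_adj_add_box: "distinct_adj r \<Longrightarrow> distinct_adj (add_box r)"
  by (auto simp: add_box_def distinct_adj_append_iff)

lemma add_box_alternating: "n > 0 \<Longrightarrow> add_box (alternating s n) = alternating s (Suc n)"
  by (cases n) (simp_all only: add_box_def alternating_Suc_snoc last_snoc, simp_all)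

lemma distinct_adj_snoc: "distinct_adj (r @ [s]) \<Longrightarrow> r \<noteq> [] \<Longrightarrow> r @ [s] = add_box r"
  by (auto simp: add_box_def distinct_adj_append_iff neq_flip_sign)

lemma map_flip_sign_add_box: "r \<noteq> [] \<Longrightarrow> map flip_sign (add_box r) = add_box (map flip_sign r)"
  by (simp add: add_box_def last_map)

text \<open>The only candidate for the lift: rows of length one fill up the signature. The
  subtractions truncate; they are exact precisely when the result has signature
  \<open>(p, q)\<close>.\<close>

definition lift_diagram :: "nat \<Rightarrow> nat \<Rightarrow> row multiset \<Rightarrow> row multiset"
  where "lift_diagram p q D = image_mset add_box D +
    replicate_mset (p - sign_count Pos (image_mset add_box D)) [Pos] +
    replicate_mset (q - sign_count Neg (image_mset add_box D)) [Neg]"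

lemma lift_diagram_unique:
  assumes E: "E = image_mset add_box D + replicate_mset a [Pos] + replicate_mset b [Neg]"
    and "sign_count Pos E = p" "sign_count Neg E = q"
  shows "E = lift_diagram p q D"
    and "a = p - sign_count Pos (image_mset add_box D)"
    and "b = q - sign_count Neg (image_mset add_box D)"
  using assms by (auto simp: lift_diagram_def)

lemma rel_mset_union:
  assumes "rel_mset R A B" "rel_mset R C D"
  shows "rel_mset R (A + C) (B + D)"
  using assms by (induction rule: rel_mset_induct) (auto intro: rel_mset_Plus)

lemma rel_mset_image:
  assumes "\<And>r. R r (f r)"
  shows "rel_mset R A (image_mset f A)"
  by (induction A) (auto intro: rel_mset_Plus rel_mset_Zero assms)

lemma add_boxes_lift:
  "add_boxes (a + b) D (image_mset add_box D + replicate_mset a [Pos] + replicate_mset b [Neg])"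
proof -
  let ?R = "\<lambda>r' r. \<exists>s :: sign. r = r' @ [s]"
  have rep: "rel_mset ?R (replicate_mset c []) (replicate_mset c [s])" for c s
    using rel_mset_image[of ?R "\<lambda>r. r @ [s]" "replicate_mset c []"] by simp
  have "rel_mset ?R (D + replicate_mset a [] + replicate_mset b [])
      (image_mset add_box D + replicate_mset a [Pos] + replicate_mset b [Neg])"
    by (intro rel_mset_union rep rel_mset_image) (auto simp: add_box_def)
  moreover have "replicate_mset (a + b) ([] :: row) = replicate_mset a [] + replicate_mset b []"
    by (simp add: multiset_eq_iff)
  ultimately show ?thesis by (simp add: add_boxes_def add.assoc)
qed

lemma singleton_rows:
  assumes "\<And>r. r \<in># M \<Longrightarrow> r = [Pos] \<or> r = [Neg]"
  shows "M = replicate_mset (count M [Pos]) [Pos] + replicate_mset (count M [Neg]) [Neg]"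
proof (rule multiset_eqI)
  fix r
  show "count M r = count (replicate_mset (count M [Pos]) [Pos] + replicate_mset (count M [Neg]) [Neg]) r"
    using assms[of r] by (cases "r \<in># M") (auto simp: not_in_iff)
qed

text \<open>The multiset of pairs witnessing the relation splits into the pairs over
  \<open>D\<close>, where alternation forces the added sign, and those over empty rows, which become
  single boxes of either sign.\<close>

lemma add_boxesE:
  assumes "add_boxes k D E" "signed_young_diagram E" and ne: "[] \<notin># D"
  obtains a b where "k = a + b"
    "E = image_mset add_box D + replicate_mset a [Pos] + replicate_mset b [Neg]"
proof -
  obtain Z where Z: "\<And>r' r. (r', r) \<in># Z \<Longrightarrow> \<exists>s. r = r' @ [s]"
    "image_mset fst Z = D + replicate_mset k []" "image_mset snd Z = E"
    using assms(1) unfolding add_boxes_def multiset.in_rel by (auto simp: subset_iff)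
  obtain X Y where Z': "Z = X + Y" "image_mset fst X = D" "image_mset fst Y = replicate_mset k []"
    using image_mset_eq_plusD[OF Z(2)] by metis
  have "snd p = add_box (fst p)" if pX: "p \<in># X" for p
  proof -
    obtain r' r where p: "p = (r', r)" by (cases p)
    obtain s where s: "r = r' @ [s]" using Z(1)[of r' r] pX by (auto simp: Z' p)
    have "fst p \<in># D" unfolding Z'(2)[symmetric] using pX by simp
    then have "r' \<noteq> []" using ne by (auto simp: p)
    moreover have "snd p \<in># E" unfolding Z(3)[symmetric] Z'(1) using pX by simp
    then have "distinct_adj r" using assms(2) by (auto simp: p signed_young_diagram_def)
    ultimately show ?thesis using distinct_adj_snoc s by (simp add: p)
  qed
  then have X: "image_mset snd X = image_mset add_box D"
    unfolding Z'(2)[symmetric] by (simp add: image_mset.compositionality cong: image_mset_cong)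
  have Y: "r = [Pos] \<or> r = [Neg]" if r: "r \<in># image_mset snd Y" for r
  proof -
    obtain r' where r': "(r', r) \<in># Y" using r by auto
    then have "fst (r', r) \<in># image_mset fst Y" by (simp only: set_image_mset image_eqI)
    then have "r' \<in># image_mset fst Y" by simp
    then have "r' = []" unfolding Z'(3) by (simp split: if_splits)
    then obtain s where "r = [s]" using Z(1)[of r' r] r' by (auto simp: Z')
    then show ?thesis by (cases s) auto
  qed
  let ?Y = "image_mset snd Y"
  have Y': "?Y = replicate_mset (count ?Y [Pos]) [Pos] + replicate_mset (count ?Y [Neg]) [Neg]"
    by (rule singleton_rows) (rule Y)
  have "size ?Y = k" using arg_cong[OF Z'(3), where f = size] by simp
  then have "k = count ?Y [Pos] + count ?Y [Neg]"
    using arg_cong[OF Y', where f = size] by simp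
  moreover have "E = image_mset add_box D + replicate_mset (count ?Y [Pos]) [Pos] + replicate_mset (count ?Y [Neg]) [Neg]"
    unfolding add.assoc Y'[symmetric] X[symmetric] Z(3)[symmetric] Z'(1) by simp
  ultimately show ?thesis by (rule that)
qed

text \<open>Uniqueness among all signed Young diagrams of signature \<open>(p, q)\<close>, which
  covers the three families of diagrams at once.\<close>

lemma lift_diagram_add_boxes:
  assumes "[] \<notin># D"
  shows "\<exists>k. add_boxes k D (lift_diagram p q D) \<and>
    (\<forall>k\<^sub>2 E. add_boxes k\<^sub>2 D E \<and> signed_young_diagram E \<and> signature E = (p, q) \<longrightarrow>
      k\<^sub>2 = k \<and> E = lift_diagram p q D)"
proof (intro exI conjI allI impI; (elim conjE)?)
  show "add_boxes ((p - sign_count Pos (image_mset add_box D)) + (q - sign_count Neg (image_mset add_box D)))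
      D (lift_diagram p q D)"
    unfolding lift_diagram_def by (rule add_boxes_lift)
next
  fix k\<^sub>2 E assume E: "add_boxes k\<^sub>2 D E" "signed_young_diagram E" "signature E = (p, q)"
  obtain a b where ab: "k\<^sub>2 = a + b"
    "E = image_mset add_box D + replicate_mset a [Pos] + replicate_mset b [Neg]"
    using add_boxesE[OF E(1,2) assms] .
  have "sign_count Pos E = p" "sign_count Neg E = q" using E(3) by (simp_all add: signature_eq)
  note u = lift_diagram_unique[OF ab(2) this]
  show "k\<^sub>2 = p - sign_count Pos (image_mset add_box D) + (q - sign_count Neg (image_mset add_box D))"
    using u(2,3) ab(1) by simp
  show "E = lift_diagram p q D" by (rule u(1))
qed

text \<open>Cutting the last box off every row of \<open>E\<close> leaves the nonempty rows of
  \<open>D\<close>, because the tail counts agree, and alternation restores the cut boxes. Rows of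
  length one leave no trace in these counts; the signature supplies them.\<close>

lemma lift_diagram_eqI:
  assumes D: "signed_young_diagram D" and E: "signed_young_diagram E"
    and eq: "\<And>k e. (\<Sum>r\<in>#E. count_list (drop (Suc k) r) e) = tail_count k ((flip_sign ^^ Suc k) e) D"
    and sc: "sign_count Pos E = p" "sign_count Neg E = q"
  shows "E = lift_diagram p q D"
proof -
  let ?B = "image_mset butlast E"
  have dD: "\<forall>r\<in>#D. distinct_adj r" and neD: "[] \<notin># D" and dE: "\<forall>r\<in>#E. distinct_adj r"
    and neE: "[] \<notin># E"
    using D E by (auto simp: signed_young_diagram_def)
  have butlast: "butlast r = alternating s (length r - 1)" if "r = alternating s (length r)" for r s
    by (rule trans[OF arg_cong[OF that, where f = butlast] butlast_alternating])
  have dB: "\<forall>r\<in>#?B. distinct_adj r"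
  proof
    fix r assume "r \<in># ?B"
    then obtain r' where r': "r' \<in># E" "r = butlast r'" by auto
    have "distinct_adj r'" using dE r'(1) by blast
    then obtain s where "r' = alternating s (length r')" by (rule alternating_cases)
    then have "r = alternating s (length r' - 1)" unfolding r'(2) by (rule butlast)
    then show "distinct_adj r" by (simp add: distinct_adj_alternating)
  qed
  have "tail_count k e ?B = tail_count k e D" for k e
  proof -
    \<comment> \<open>Up to a shift of signs, dropping boxes at the front of an alternating row
      amounts to cutting as many at its end: one for the removed box and \<open>k\<close> for the
      power.\<close>
    have "count_list (drop (Suc k) r) ((flip_sign ^^ Suc k) e) = count_list (take (length (butlast r) - k) (butlast r)) e"
      if "r \<in># E" for r
    proof -
      have "distinct_adj r" using dE that by blast
      then obtain s n where s: "r = alternating s n" by (rule alternating_cases)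
      have "drop (Suc k) r = alternating ((flip_sign ^^ Suc k) s) (n - Suc k)"
        by (simp only: s drop_alternating)
      moreover have "take (length (butlast r) - k) (butlast r) = alternating s (n - Suc k)"
        by (simp add: s butlast_alternating take_alternating)
      ultimately show ?thesis
        by (simp only: count_list_alternating_flip_pow flip_sign_pow_flip_sign_pow)
    qed
    then have "tail_count k e ?B = (\<Sum>r\<in>#E. count_list (drop (Suc k) r) ((flip_sign ^^ Suc k) e))"
      by (simp add: tail_count_def image_mset.compositionality comp_def cong: image_mset_cong)
    then show ?thesis using eq by (simp only: flip_sign_pow_flip_sign_pow)
  qed
  then have cnt: "count ?B r = count D r" if "r \<noteq> []" for r
    using count_eq_if_tail_count_eq[OF dB dD _ that] by blast
  have "D = {#r \<in># ?B. r \<noteq> []#}"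
    using cnt neD by (intro multiset_eqI) (auto simp: not_in_iff)
  also have "\<dots> = image_mset butlast {#r \<in># E. butlast r \<noteq> []#}"
    by (simp add: filter_mset_image_mset)
  finally have "image_mset add_box D = image_mset (\<lambda>r. add_box (butlast r)) {#r \<in># E. butlast r \<noteq> []#}"
    by (simp add: image_mset.compositionality comp_def)
  also have "\<dots> = image_mset id {#r \<in># E. butlast r \<noteq> []#}"
  proof (rule image_mset_cong)
    fix r assume "r \<in># {#r \<in># E. butlast r \<noteq> []#}"
    then have "distinct_adj (butlast r @ [last r])" "butlast r \<noteq> []"
      using dE by (auto, metis append_butlast_last_id butlast.simps(1))
    then show "add_box (butlast r) = id r"
      using distinct_adj_snoc[of "butlast r" "last r"] by (metis append_butlast_last_id butlast.simps(1) id_apply)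
  qed
  finally have A: "image_mset add_box D = {#r \<in># E. butlast r \<noteq> []#}" by simp
  let ?M = "{#r \<in># E. butlast r = []#}"
  have "r = [Pos] \<or> r = [Neg]" if "r \<in># ?M" for r
  proof -
    have "r \<noteq> []" "butlast r = []" using that neE by auto
    then obtain s where "r = [s]" by (cases r) (auto split: if_splits)
    then show ?thesis by (cases s) auto
  qed
  then have M: "?M = replicate_mset (count ?M [Pos]) [Pos] + replicate_mset (count ?M [Neg]) [Neg]"
    by (rule singleton_rows)
  have "E = image_mset add_box D + ?M"
    unfolding A using multiset_partition[of E "\<lambda>r. butlast r \<noteq> []"] by simp
  then have "E = image_mset add_box D + replicate_mset (count ?M [Pos]) [Pos] + replicate_mset (count ?M [Neg]) [Neg]"
    using M by (metis add.assoc)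
  from lift_diagram_unique(1)[OF this sc] show ?thesis .
qed

lemma signed_young_lift_diagram:
  assumes "signed_young_diagram D"
  shows "signed_young_diagram (lift_diagram p q D)"
  using assms
  by (auto simp: signed_young_diagram_def lift_diagram_def distinct_adj_add_box split: if_splits)

section \<open>Rewriting and halving of rows under the addition of boxes\<close>

definition rewrite_row :: "(nat \<Rightarrow> bool) \<Rightarrow> row \<Rightarrow> row"
  where "rewrite_row P r = (if P (length r) \<and> hd r = Neg then map flip_sign r else r)"

lemma rewrite_rows_eq: "rewrite_rows P D = image_mset (rewrite_row P) D"
  by (simp add: rewrite_rows_def rewrite_row_def[abs_def])

text \<open>The inverse of halving: a halved diagram together with its image under
  \<open>flip_row P\<close> gives each exceptional row a partner of opposite signs and doubles every
  other row.\<close>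

definition flip_row :: "(nat \<Rightarrow> bool) \<Rightarrow> row \<Rightarrow> row"
  where "flip_row P r = (if P (length r) then map flip_sign r else r)"

lemma flip_row_flip_row [simp]: "flip_row P (flip_row P r) = r"
  by (simp add: flip_row_def)

lemma distinct_adj_map_flip_sign [simp]: "distinct_adj (map flip_sign r) \<longleftrightarrow> distinct_adj r"
  by (simp add: distinct_adj_conv_nth)

text \<open>A row of even length has as many \<open>Pos\<close> as \<open>Neg\<close>.\<close>

lemma count_list_even_row:
  assumes "distinct_adj r" "even (length r)"
  shows "count_list (map flip_sign r) e = count_list r e"
  using alternating_hd_length[OF assms(1)] count_list_alternating_even[OF assms(2)]
  by (metis map_flip_sign_alternating)

lemma sign_count_even_rows:
  assumes "signed_young_diagram D"
  shows "sign_count e (image_mset (rewrite_row even) D) = sign_count e D"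
    and "sign_count e (image_mset (flip_row even) D) = sign_count e D"
  using assms count_list_even_row
  by (auto simp: rewrite_row_def flip_row_def signed_young_diagram_def intro!: sign_count_image)

text \<open>The new box turns odd length into even and keeps the first sign, so the exceptional rows
  for \<open>G'\<close> become those for \<open>G\<close>.\<close>

lemma row_add_box:
  assumes "r \<noteq> []"
  shows "rewrite_row even (add_box r) = add_box (rewrite_row odd r)"
    and "flip_row even (add_box r) = add_box (flip_row odd r)"
  using assms by (auto simp: rewrite_row_def flip_row_def hd_add_box map_flip_sign_add_box)

lemma signed_young_add_box:
  "signed_young_diagram D \<Longrightarrow> signed_young_diagram (image_mset add_box D)"
  by (auto simp: signed_young_diagram_def distinct_adj_add_box)

lemma image_row_add_box:
  assumes "[] \<notin># D"
  shows "image_mset add_box (image_mset (rewrite_row odd) D) = image_mset (rewrite_row even) (image_mset add_box D)"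
    and "image_mset add_box (image_mset (flip_row odd) D) = image_mset (flip_row even) (image_mset add_box D)"
proof -
  have "r \<noteq> []" if "r \<in># D" for r using assms that by auto
  then show "image_mset add_box (image_mset (rewrite_row odd) D) = image_mset (rewrite_row even) (image_mset add_box D)"
    "image_mset add_box (image_mset (flip_row odd) D) = image_mset (flip_row even) (image_mset add_box D)"
    by (auto simp: image_mset.compositionality comp_def row_add_box intro!: image_mset_cong)
qed

lemma rewrite_rows_lift_diagram:
  assumes D: "signed_young_diagram D"
  shows "rewrite_rows even (lift_diagram p q D) = lift_diagram p q (rewrite_rows odd D)"
proof -
  have ne: "[] \<notin># D" using D by (auto simp: signed_young_diagram_def)
  show ?thesis
    unfolding lift_diagram_def rewrite_rows_eq image_row_add_box(1)[OF ne]
      sign_count_even_rows(1)[OF signed_young_add_box[OF D]]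
    by (simp add: rewrite_row_def)
qed

lemma count_rewrite_rows_even:
  assumes "even (length r)" "hd r = Pos" "r \<noteq> []"
  shows "count (rewrite_rows even D) r = count D r + count D (map flip_sign r)"
proof (induction D)
  case (add x D)
  have hd: "hd (map flip_sign r) = Neg" using assms by (simp add: hd_map)
  then have "map flip_sign r \<noteq> r" using assms(2) by force
  have "rewrite_row even x = r \<longleftrightarrow> x = r \<or> x = map flip_sign r"
    using assms hd by (auto simp: rewrite_row_def)
  then show ?case
    using add \<open>map flip_sign r \<noteq> r\<close> by (auto simp: rewrite_rows_eq)
qed (simp add: rewrite_rows_eq)

lemma count_lift_diagram:
  assumes "n > 0"
  shows "count (lift_diagram p q D) (alternating s (Suc n)) = count D (alternating s n)"
proof -
  have "count (image_mset add_box D) (add_box r) = count D r" for r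
    by (induction D) auto
  moreover have "alternating s (Suc n) \<noteq> [e]" for e using assms by (cases n) auto
  ultimately show ?thesis
    using add_box_alternating[OF assms, of s] by (simp add: lift_diagram_def del: alternating.simps)
      (metis)
qed

text \<open>A rewritten row of even length \<open>Suc n\<close> comes from the rows of odd length
  \<open>n\<close> in \<open>D\<close> with either initial sign. These are equally many by
  \<open>sym\<close>, hence the even multiplicity.\<close>

lemma O_diagram_lift:
  assumes D: "signed_young_diagram D" and sig: "signature (lift_diagram p q D) = (p, q)"
    and sym: "\<And>n. odd n \<Longrightarrow> count D (alternating Pos n) = count D (alternating Neg n)"
  shows "O_diagram p q (lift_diagram p q (rewrite_rows odd D))"
proof -
  let ?L = "lift_diagram p q D"
  have L: "signed_young_diagram ?L" by (rule signed_young_lift_diagram[OF D])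
  have eq: "lift_diagram p q (rewrite_rows odd D) = rewrite_rows even ?L"
    by (simp add: rewrite_rows_lift_diagram[OF D])
  have "signed_young_diagram (rewrite_rows even ?L)"
    using L by (auto simp: signed_young_diagram_def rewrite_rows_def)
  moreover have "signature (rewrite_rows even ?L) = (p, q)"
    using sig sign_count_even_rows(1)[OF L] by (simp add: signature_eq rewrite_rows_eq)
  moreover have "hd r = Pos \<and> even (count (rewrite_rows even ?L) r)"
    if r: "r \<in># rewrite_rows even ?L" "even (length r)" for r
  proof -
    have hd: "hd r = Pos"
    proof -
      obtain x where x: "x \<in># ?L" "r = rewrite_row even x" using r(1) by (auto simp: rewrite_rows_eq)
      have "x \<noteq> []" using L x(1) by (auto simp: signed_young_diagram_def)
      then show ?thesis using r(2)
        by (cases "hd x") (auto simp: x(2) rewrite_row_def hd_map split: if_splits)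
    qed
    have "r \<noteq> []" "distinct_adj r"
      using calculation(1) r(1) by (auto simp: signed_young_diagram_def)
    then obtain n where n: "r = alternating Pos (Suc n)" "odd n"
      using alternating_hd_length[of r] hd r(2) by (cases "length r") auto
    then have n0: "n > 0" by (cases n) auto
    have "count (rewrite_rows even ?L) r = count D (alternating Pos n) + count D (alternating Neg n)"
      using count_rewrite_rows_even[OF r(2) hd \<open>r \<noteq> []\<close>, of ?L] count_lift_diagram[OF n0, of p q D]
      by (simp only: n(1) map_flip_sign_alternating flip_sign.simps)
    then show ?thesis using hd sym[OF n(2)] by simp
  qed
  ultimately show ?thesis by (simp add: O_diagram_def eq)
qed

text \<open>For odd rows \<open>sym\<close> supplies the discarded partners beginning with
  \<open>Neg\<close>; for even rows the halved multiplicity is doubled.\<close>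

lemma halve_rows_split:
  assumes D: "signed_young_diagram D" and H: "halve_rows odd D \<Lambda>"
    and sym: "\<And>n. odd n \<Longrightarrow> count D (alternating Pos n) = count D (alternating Neg n)"
  shows "D = \<Lambda> + image_mset (flip_row odd) \<Lambda>"
proof (rule multiset_eqI)
  fix r
  have c: "count (image_mset (flip_row P) \<Lambda>) r = count \<Lambda> (flip_row P r)" for P
    by (induction \<Lambda>) auto
  have odd: "count \<Lambda> r = (if hd r = Pos then count D r else 0)" if "odd (length r)" for r
    using H that by (auto simp: halve_rows_def)
  show "count D r = count (\<Lambda> + image_mset (flip_row odd) \<Lambda>) r"
  proof (cases "odd (length r)")
    case True
    then have "r \<noteq> []" by auto
    then have hd: "hd (map flip_sign r) = flip_sign (hd r)" by (simp add: hd_map)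
    have "count D (map flip_sign r) = count D r"
    proof (cases "distinct_adj r")
      case dr: True
      show ?thesis
        using alternating_hd_length[OF dr] sym[OF True]
        by (cases "hd r") (metis flip_sign.simps map_flip_sign_alternating)+
    next
      case False
      then have "r \<notin># D" "map flip_sign r \<notin># D" using D by (auto simp: signed_young_diagram_def)
      then show ?thesis by (simp add: not_in_iff)
    qed
    then show ?thesis
      using odd[of r] odd[of "map flip_sign r"] True hd
      by (cases "hd r") (auto simp: c flip_row_def)
  next
    case False
    then have "2 * count \<Lambda> r = count D r" using H by (auto simp: halve_rows_def)
    then show ?thesis using False by (simp add: c flip_row_def)
  qed
qed

lemma lift_diagram_halve:
  assumes D: "signed_young_diagram D" and H: "halve_rows odd D \<Lambda>"
    and sym: "\<And>n. odd n \<Longrightarrow> count D (alternating Pos n) = count D (alternating Neg n)"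
    and sig: "signature (lift_diagram (2 * p) (2 * q) D) = (2 * p, 2 * q)"
  shows "halve_rows even (lift_diagram (2 * p) (2 * q) D) (lift_diagram p q \<Lambda>)"
    and "Sp_diagram p q (lift_diagram p q \<Lambda>)" and "[] \<notin># \<Lambda>"
proof -
  have split: "D = \<Lambda> + image_mset (flip_row odd) \<Lambda>"
    by (rule halve_rows_split[OF D H sym])
  let ?L = "lift_diagram p q \<Lambda>" and ?E = "lift_diagram (2 * p) (2 * q) D"
  have \<Lambda>: "signed_young_diagram \<Lambda>" using D by (subst (asm) split) (auto simp: signed_young_diagram_def)
  then show ne: "[] \<notin># \<Lambda>" by (auto simp: signed_young_diagram_def)
  have sc: "sign_count e (image_mset add_box D) = 2 * sign_count e (image_mset add_box \<Lambda>)" for e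
    by (subst split) (simp only: image_mset_union image_row_add_box(2)[OF ne] sign_count_union
        sign_count_even_rows(2)[OF signed_young_add_box[OF \<Lambda>]] mult_2)
  have img: "image_mset add_box D = image_mset add_box \<Lambda> + image_mset (flip_row even) (image_mset add_box \<Lambda>)"
    by (subst split) (simp only: image_mset_union image_row_add_box(2)[OF ne])
  have E: "?E = ?L + image_mset (flip_row even) ?L"
    \<comment> \<open>The counts of the boxed rows double, hence so do the truncated differences;
      rows of length one are odd and are fixed by \<open>flip_row even\<close>.\<close>
    unfolding lift_diagram_def sc
    unfolding img diff_mult_distrib2[symmetric]
    by (simp add: flip_row_def multiset_eq_iff)
  have L: "signed_young_diagram ?L" by (rule signed_young_lift_diagram[OF \<Lambda>])
  have sigL: "signature ?L = (p, q)"
    using sig unfolding E by (simp add: signature_eq sign_count_even_rows(2)[OF L])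
  have hd: "hd r = Pos" if r: "r \<in># ?L" "even (length r)" for r
  proof -
    have "r \<in># image_mset add_box \<Lambda>" using r by (auto simp: lift_diagram_def split: if_splits)
    then obtain x where x: "x \<in># \<Lambda>" "r = add_box x" by auto
    have "count \<Lambda> x = (if hd x = Pos then count D x else 0)"
      using H r(2) by (auto simp: x(2) halve_rows_def)
    then have "hd x = Pos" using x(1) by (metis not_in_iff)
    moreover have "x \<noteq> []" using x(1) ne by auto
    ultimately show ?thesis by (simp add: x(2) hd_add_box)
  qed
  show "Sp_diagram p q ?L" using L sigL hd by (auto simp: Sp_diagram_def)
  have c: "count (image_mset (flip_row P) M) r = count M (flip_row P r)" for P M r
    by (induction M) auto
  show "halve_rows even ?E ?L"
    unfolding halve_rows_def
  proof
    fix r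
    show "if even (length r) then count ?L r = (if hd r = Pos then count ?E r else 0)
        else 2 * count ?L r = count ?E r"
    proof (cases "even (length r)")
      case True
      show ?thesis
      proof (cases "r = []")
        case True
        then show ?thesis using L by (auto simp: E c flip_row_def signed_young_diagram_def not_in_iff)
      next
        case False
        then have "hd (map flip_sign r) = flip_sign (hd r)" by (simp add: hd_map)
        then show ?thesis
          using True hd[of r] hd[of "map flip_sign r"]
          by (cases "hd r") (auto simp: E c flip_row_def simp flip: not_in_iff)
      qed
    qed (simp add: E c flip_row_def)
  qed
qed

text \<open>The lengths of the rows of \<open>D\<close> bound the exponents with nonzero rank, so
  \<open>z\<close> is nilpotent and has some diagram \<open>E\<close>. Exponent zero gives the
  signature of \<open>E\<close>, positive exponents its rows without their last boxes.\<close>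

lemma full_diagram_lift:
  fixes z :: "('p::finite + 'q::finite, 'p + 'q) cmat"
  assumes z: "graded flip_sign z" and x: "graded flip_sign x" and D: "full_diagram' x D"
    and lift: "\<And>k e. pow_dim z (Suc k) e = pow_dim x k ((flip_sign ^^ Suc k) e)"
  shows "full_diagram z (lift_diagram CARD('p) CARD('q) D)"
    and "signature (lift_diagram CARD('p) CARD('q) D) = (CARD('p), CARD('q))"
    and "signed_young_diagram D"
proof -
  note xD = full_diagram'_pow_dim[OF x D]
  show "signed_young_diagram D" by (rule xD(2))
  obtain N where N: "\<And>r. r \<in># D \<Longrightarrow> length r \<le> N"
    using finite_set_mset[of D] by (metis finite_imageI finite_nat_set_iff_bounded_le imageI)
  then have "pow_dim z (Suc N) e = 0" for e
    by (simp add: lift xD(1))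
  from ex_full_diagram[OF z this] obtain E where E: "full_diagram z E" by blast
  note zE = full_diagram_pow_dim[OF z E]
  have "sign_count e E = pow_dim z 0 e" for e
    by (simp add: zE(1) sign_count_def)
  then have sc: "sign_count Pos E = CARD('p)" "sign_count Neg E = CARD('q)"
    by (simp_all add: pow_dim_def dim_sign_space)
  have "E = lift_diagram CARD('p) CARD('q) D"
    by (rule lift_diagram_eqI[OF xD(2) zE(2) _ sc])
      (simp only: zE(1)[symmetric] lift tail_count_def xD(1))
  then show "full_diagram z (lift_diagram CARD('p) CARD('q) D)"
    "signature (lift_diagram CARD('p) CARD('q) D) = (CARD('p), CARD('q))"
    using E sc by (simp_all add: signature_eq)
qed

lemma full_diagram'_symmetric:
  assumes x: "graded flip_sign x" and D: "full_diagram' x D"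
    and sym: "\<And>j. even j \<Longrightarrow> pow_dim x j Pos = pow_dim x j Neg" and n: "odd n"
  shows "count D (alternating Pos n) = count D (alternating Neg n)"
  using full_diagram'_pow_dim[OF x D] sym n
  by (intro count_alternating_symmetric) (auto simp: signed_young_diagram_def tail_count_def)

section \<open>Ranks under the theta lift\<close>

lemma sum_UNIV_Plus:
  fixes f :: "'a::finite + 'b::finite \<Rightarrow> 'c::comm_monoid_add"
  shows "(\<Sum>i\<in>UNIV. f i) = (\<Sum>a\<in>UNIV. f (Inl a)) + (\<Sum>b\<in>UNIV. f (Inr b))"
  unfolding UNIV_Plus_UNIV[symmetric] by (subst sum.Plus) (auto simp: comp_def)

lemma four_block_mult:
  "four_block A B C D ** four_block A' B' C' D' =
    four_block (A ** A' + B ** C') (A ** B' + B ** D') (C ** A' + D ** C') (C ** B' + D ** D')"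
  by (simp add: vec_eq_iff matrix_matrix_mult_def four_block_def sum_UNIV_Plus split_sum_all)

lemma transpose_four_block:
  "transpose (four_block A B C D) = four_block (transpose A) (transpose C) (transpose B) (transpose D)"
  by (simp add: vec_eq_iff transpose_def four_block_def split_sum_all)

lemma four_block_mat_1: "four_block (mat 1) 0 0 (mat 1) = mat 1"
  by (simp add: vec_eq_iff mat_def four_block_def split_sum_all)

lemma matrix_mult_zero [simp]:
  fixes M :: "'a::semiring_1^'n^'m"
  shows "M ** 0 = 0" "0 ** M = 0"
  by (simp_all add: vec_eq_iff matrix_matrix_mult_def)

lemma transpose_zero [simp]: "transpose 0 = 0"
  by (simp add: vec_eq_iff transpose_def)

lemma continuous_on_four_block [continuous_intros]:
  assumes "continuous_on S A" "continuous_on S B" "continuous_on S C" "continuous_on S D"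
  shows "continuous_on S (\<lambda>y. four_block (A y) (B y) (C y) (D y))"
  unfolding four_block_def
proof (intro continuous_on_vec_lambda)
  fix i j
  show "continuous_on S (\<lambda>y. case i of
      Inl a \<Rightarrow> (case j of Inl c \<Rightarrow> A y $ a $ c | Inr d \<Rightarrow> B y $ a $ d)
    | Inr b \<Rightarrow> (case j of Inl c \<Rightarrow> C y $ b $ c | Inr d \<Rightarrow> D y $ b $ d))"
    by (cases i; cases j) (simp_all add: continuous_on_component assms)
qed

definition cscale :: "complex \<Rightarrow> ('a::finite, 'b::finite) cmat \<Rightarrow> ('a, 'b) cmat"
  where "cscale c M = (\<chi> i j. c * M $ i $ j)"

lemma cscale_simps [simp]:
  "cscale c M ** N = cscale c (M ** N)"
  "M' ** cscale c N = cscale c (M' ** N)"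
  "cscale c (cscale d M) = cscale (c * d) M"
  "cscale 1 M = M" "cscale c 0 = 0" "cscale (-1) M = - M"
  by (simp_all add: vec_eq_iff cscale_def matrix_matrix_mult_def sum_distrib_left mult_ac)

lemma transpose_cscale [simp]: "transpose (cscale c M) = cscale c (transpose M)"
  by (simp add: vec_eq_iff cscale_def transpose_def)

lemma cscale_diff: "cscale c (M - N) = cscale c M - cscale c N"
  by (simp add: vec_eq_iff cscale_def algebra_simps)

lemma cscale_vec: "cscale c M *v v = c *s (M *v v)"
  by (simp add: vec_eq_iff cscale_def matrix_vector_mult_def sum_distrib_left mult.assoc)

lemma cscale_four_block:
  "cscale c (four_block A B C D) = four_block (cscale c A) (cscale c B) (cscale c C) (cscale c D)"
  by (simp add: vec_eq_iff cscale_def four_block_def split_sum_all)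

lemma transpose_add: "transpose (M + N) = transpose M + transpose N"
  and transpose_diff: "transpose (M - N) = transpose M - transpose (N :: 'a::ab_group_add^'n^'m)"
  and transpose_uminus: "transpose (- N) = - transpose N"
  by (simp_all add: vec_eq_iff transpose_def)

lemma matrix_mult_uminus [simp]:
  fixes M :: "'a::ring_1^'n^'m"
  shows "(- M) ** N = - (M ** N)" "M ** (- N) = - (M ** N)"
  by (simp_all add: vec_eq_iff matrix_matrix_mult_def sum_negf)

lemma matrix_inv_inverse:
  fixes M :: "'a::field^'n^'n"
  assumes "invertible M"
  shows "M ** matrix_inv M = mat 1" "matrix_inv M ** M = mat 1"
  using someI_ex[OF assms[unfolded invertible_def]] by (simp_all add: matrix_inv_def)

lemma matrix_inv_unique:
  fixes M :: "'a::field^'n^'n"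
  assumes "M ** N = mat 1"
  shows "matrix_inv M = N"
proof -
  have "N ** M = mat 1" using assms by (simp add: matrix_left_right_inverse)
  then have "invertible M" using assms by (auto simp: invertible_def)
  then have "matrix_inv M ** (M ** N) = N"
    by (simp add: matrix_mul_assoc matrix_inv_inverse)
  then show ?thesis using assms by simp
qed

lemma matrix_mul_cancel:
  fixes M :: "'a::field^'n^'n"
  assumes "M ** N = mat 1"
  shows "M ** (N ** P) = P" "Q ** M ** N = Q"
  using assms by (simp add: matrix_mul_assoc, simp flip: matrix_mul_assoc)

text \<open>Transposing \<open>assoc' (X, Y)\<close> puts \<open>transpose Y\<close> in the upper
  block, so \<open>S1 ** T2\<close> is matched with \<open>Y\<close> and \<open>S2 ** T1\<close>
  with \<open>X\<close>.\<close>

lemma pow_dim_lift_blocks: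
  fixes X :: "('m::finite, 'n::finite) cmat" and Y :: "('n, 'm) cmat"
    and T1 :: "('p::finite, 'm) cmat" and T2 :: "('q::finite, 'n) cmat"
    and S1 :: "('m, 'q) cmat" and S2 :: "('n, 'p) cmat"
  assumes z: "z = four_block 0 (T1 ** S1) (T2 ** S2) 0"
    and ST: "S1 ** T2 = cscale c (transpose Y)" "S2 ** T1 = cscale c (transpose X)" and c: "c \<noteq> 0"
  shows "pow_dim z (Suc k) e \<le> pow_dim (assoc' (X, Y)) k ((flip_sign ^^ Suc k) e)"
    and "L1 ** T1 = mat 1 \<Longrightarrow> L2 ** T2 = mat 1 \<Longrightarrow> S1 ** R1 = mat 1 \<Longrightarrow> S2 ** R2 = mat 1 \<Longrightarrow>
      pow_dim z (Suc k) e = pow_dim (assoc' (X, Y)) k ((flip_sign ^^ Suc k) e)"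
proof -
  let ?T = "four_block T1 0 0 T2" and ?S = "four_block 0 S1 S2 0"
  have z': "z = ?T ** ?S" by (simp add: z four_block_mult)
  have "?S ** ?T = cscale c (transpose (assoc' (X, Y)))"
    by (simp add: four_block_mult assoc'_def transpose_four_block cscale_four_block ST)
  then have ST': "?S *v (?T *v v) = c *s (transpose (assoc' (X, Y)) *v v)" for v
    by (simp add: matrix_vector_mul_assoc cscale_vec del: transpose_matrix_vector)
  have gr: "graded flip_sign ?S" "graded flip_sign (assoc' (X, Y))"
    by (simp_all add: assoc'_def graded_four_block)
  show "pow_dim z (Suc k) e \<le> pow_dim (assoc' (X, Y)) k ((flip_sign ^^ Suc k) e)"
    by (rule pow_dim_lift_le[OF z' ST' c gr])
  assume inv: "L1 ** T1 = mat 1" "L2 ** T2 = mat 1" "S1 ** R1 = mat 1" "S2 ** R2 = mat 1"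
  have "four_block L1 0 0 L2 ** ?T = mat 1" "?S ** four_block 0 R2 R1 0 = mat 1"
    by (simp_all add: four_block_mult inv four_block_mat_1)
  then have "inj ((*v) ?T)" "surj ((*v) ?S)"
    using matrix_left_invertible_injective[of ?T] matrix_right_invertible_surjective[of ?S] by blast+
  then show "pow_dim z (Suc k) e = pow_dim (assoc' (X, Y)) k ((flip_sign ^^ Suc k) e)"
    by (rule pow_dim_lift_eq[OF z' ST' c gr])
qed

lemma pow_dim_conj_blocks:
  fixes X :: "('m::finite, 'n::finite) cmat" and g1 :: "('m, 'm) cmat" and g2 :: "('n, 'n) cmat"
  assumes "g1 ** X = X' ** g2" "g2 ** Y = Y' ** g1"
    and "g1 ** h1 = mat 1" "g2 ** h2 = mat 1"
  shows "pow_dim (four_block 0 X' Y' 0) k e = pow_dim (four_block 0 X Y 0) k e"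
proof -
  have "h1 ** g1 = mat 1" "h2 ** g2 = mat 1"
    using assms(3,4) by (simp_all add: matrix_left_right_inverse)
  then show ?thesis
    using pow_dim_conj[where f = id and h = "four_block g1 0 0 g2" and h' = "four_block h1 0 0 h2"
        and z = "four_block 0 X Y 0" and z' = "four_block 0 X' Y' 0" and k = k and e = e]
    by (simp add: four_block_mult four_block_mat_1 graded_four_block assms)
qed

text \<open>\<open>?h\<close> intertwines \<open>?x\<close> with its transpose and exchanges the two
  pieces. For even \<open>j\<close> the shift of sign under transposition is trivial, so only the
  exchange remains. The value of \<open>s\<close> is 1 for symmetric and -1 for alternating
  matrices.\<close>

lemma pow_dim_symmetric:
  fixes X Y :: "('n::finite, 'n) cmat"
  assumes "transpose X = cscale s X" "transpose Y = cscale s Y" "s * s = 1" "even j"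
  shows "pow_dim (assoc' (X, Y)) j Pos = pow_dim (assoc' (X, Y)) j Neg"
proof -
  let ?x = "assoc' (X, Y)"
  let ?h = "four_block 0 (mat 1) (cscale s (mat 1)) 0 :: ('n + 'n, 'n + 'n) cmat"
  let ?h' = "four_block 0 (cscale s (mat 1)) (mat 1) 0 :: ('n + 'n, 'n + 'n) cmat"
  have gr: "graded flip_sign ?x" by (simp add: assoc'_def graded_four_block)
  have "pow_dim (transpose ?x) j (flip_sign Neg) = pow_dim ?x j Neg"
    by (rule pow_dim_conj[where h = ?h and h' = ?h'])
      (simp_all add: assoc'_def transpose_four_block four_block_mult graded_four_block assms
        four_block_mat_1)
  moreover have "(flip_sign ^^ j) Pos = Pos"
    using \<open>even j\<close> by (auto elim!: evenE simp: mult_2 funpow_add)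
  ultimately show ?thesis by (simp add: pow_dim_transpose[OF gr])
qed

text \<open>Semicontinuity on both orbit closures: a generic point of the fibre over \<open>x\<close> bounds the
  dimensions for \<open>\<O>\<close> from below, and every point of \<open>\<O>\<close> is the image of a point over the closure
  of \<open>\<O>'\<close>, which bounds them from above.\<close>

lemma theta_lift_pow_dim:
  fixes \<phi> :: "'w \<Rightarrow> 's::topological_space" and \<psi> :: "'w \<Rightarrow> 't::topological_space"
    and a :: "'s \<Rightarrow> ('p::finite + 'q::finite, 'p + 'q) cmat"
    and a' :: "'t \<Rightarrow> ('m::finite + 'n::finite, 'm + 'n) cmat"
  assumes \<theta>: "theta_lift \<phi> \<psi> \<O>' \<O>"
    and cont: "continuous_on UNIV a" "continuous_on UNIV a'"
    and inv: "\<And>y k e. y \<in> \<O> \<Longrightarrow> pow_dim (a y) k e = pow_dim (a z) k e"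
    and inv': "\<And>y k e. y \<in> \<O>' \<Longrightarrow> pow_dim (a' y) k e = pow_dim (a' x) k e"
    and le: "\<And>w k e. pow_dim (a (\<phi> w)) (Suc k) e \<le> pow_dim (a' (\<psi> w)) k ((flip_sign ^^ Suc k) e)"
    and w: "\<psi> w = x" "\<And>k e. pow_dim (a (\<phi> w)) (Suc k) e = pow_dim (a' x) k ((flip_sign ^^ Suc k) e)"
    and x: "x \<in> \<O>'" and z: "z \<in> \<O>"
  shows "pow_dim (a z) (Suc k) e = pow_dim (a' x) k ((flip_sign ^^ Suc k) e)"
proof (rule antisym)
  have \<theta>': "\<phi> ` (\<psi> -` closure \<O>') = closure \<O>" using \<theta> by (simp add: theta_lift_def)
  have "z \<in> closure \<O>" using z closure_subset by blast
  then obtain v where v: "z = \<phi> v" "\<psi> v \<in> closure \<O>'" using \<theta>' by blast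
  have "pow_dim (a' (\<psi> v)) k ((flip_sign ^^ Suc k) e) \<le> pow_dim (a' x) k ((flip_sign ^^ Suc k) e)"
    by (rule pow_dim_closure_le[OF cont(2) v(2)]) (simp add: inv')
  then show "pow_dim (a z) (Suc k) e \<le> pow_dim (a' x) k ((flip_sign ^^ Suc k) e)"
    using le[of v k e] v(1) by simp
  have "\<phi> w \<in> closure \<O>" using \<theta>' w(1) x closure_subset by blast
  then have "pow_dim (a (\<phi> w)) (Suc k) e \<le> pow_dim (a z) (Suc k) e"
    by (rule pow_dim_closure_le[OF cont(1)]) (simp add: inv)
  then show "pow_dim (a' x) k ((flip_sign ^^ Suc k) e) \<le> pow_dim (a z) (Suc k) e"
    by (simp add: w(2))
qed

section \<open>Invariance of the ranks along orbits\<close>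

lemma sympl_J_square: "sympl_J ** sympl_J = - mat 1"
  and transpose_sympl_J: "transpose sympl_J = - sympl_J"
proof -
  have neg: "four_block (- A) (- B) (- C) (- D) = - four_block A B C D" for A B C D :: "('n::finite, 'n) cmat"
    by (simp add: vec_eq_iff four_block_def split_sum_all)
  show "sympl_J ** sympl_J = (- mat 1 :: ('n::finite + 'n, 'n + 'n) cmat)"
    using neg[of "mat 1" 0 0 "mat 1"] by (simp add: sympl_J_def four_block_mult four_block_mat_1)
  show "transpose sympl_J = (- sympl_J :: ('n::finite + 'n, 'n + 'n) cmat)"
    using neg[of 0 "mat 1" "- mat 1" 0]
    by (simp add: sympl_J_def transpose_four_block transpose_uminus)
qed

text \<open>The action conjugates the associated matrix by the block diagonal matrix with blocks
  \<open>g\<close> and the inverse transpose of \<open>g\<close>.\<close>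

lemma pow_dim_act':
  assumes "g \<in> GL"
  shows "pow_dim (assoc' (act' g y)) k e = pow_dim (assoc' y) k e"
proof -
  obtain X Y where y: "y = (X, Y)" by (cases y)
  have g: "g ** matrix_inv g = mat 1" "matrix_inv g ** g = mat 1"
    using assms by (simp_all add: GL_def matrix_inv_inverse)
  have t: "transpose g ** transpose (matrix_inv g) = mat 1" "transpose (matrix_inv g) ** transpose g = mat 1"
    using g by (simp_all flip: matrix_transpose_mul)
  have inv: "matrix_inv (transpose g) = transpose (matrix_inv g)" by (rule matrix_inv_unique[OF t(1)])
  show ?thesis unfolding y act'_def assoc'_def prod.case inv
    by (rule pow_dim_conj_blocks[where ?g1.0 = g and ?g2.0 = "transpose (matrix_inv g)"
        and ?h1.0 = "matrix_inv g" and ?h2.0 = "transpose g"])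
      (simp_all add: g t matrix_mul_cancel)
qed

lemma pow_dim_act_U:
  assumes "g \<in> GL \<times> GL"
  shows "pow_dim (assoc' (act_U g y)) k e = pow_dim (assoc' y) k e"
proof -
  obtain X Y g1 g2 where y: "y = (X, Y)" "g = (g1, g2)" by (cases y; cases g)
  have g: "g1 ** matrix_inv g1 = mat 1" "matrix_inv g1 ** g1 = mat 1"
    "g2 ** matrix_inv g2 = mat 1" "matrix_inv g2 ** g2 = mat 1"
    using assms by (simp_all add: y GL_def matrix_inv_inverse)
  show ?thesis unfolding y act_U_def assoc'_def prod.case
    by (rule pow_dim_conj_blocks[where ?g1.0 = g1 and ?g2.0 = g2
        and ?h1.0 = "matrix_inv g1" and ?h2.0 = "matrix_inv g2"])
      (simp_all add: g matrix_mul_cancel)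
qed

lemma assoc_U_eq: "assoc_U = assoc'"
  by (simp add: assoc_U_def assoc'_def)

lemma pow_dim_act_O:
  assumes "g \<in> O_C \<times> O_C"
  shows "pow_dim (assoc_O (act g y)) k e = pow_dim (assoc_O y) k e"
proof -
  obtain k1 k2 where g: "g = (k1, k2)" by (cases g)
  have k: "k1 ** transpose k1 = mat 1" "transpose k1 ** k1 = mat 1"
    "k2 ** transpose k2 = mat 1" "transpose k2 ** k2 = mat 1"
    using assms by (simp_all add: g O_C_def orthogonal_matrix_def)
  have inv: "matrix_inv k2 = transpose k2" by (rule matrix_inv_unique[OF k(3)])
  show ?thesis unfolding g act_def assoc_O_def prod.case inv
    by (rule pow_dim_conj_blocks[where ?g1.0 = k1 and ?g2.0 = k2
        and ?h1.0 = "transpose k1" and ?h2.0 = "transpose k2"])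
      (simp_all add: k matrix_mul_cancel matrix_transpose_mul matrix_mul_assoc)
qed

lemma Sp_C_inverse:
  assumes "k \<in> Sp_C"
  shows "k ** (- (sympl_J ** transpose k ** sympl_J)) = mat 1"
    and "matrix_inv k = - (sympl_J ** transpose k ** sympl_J)"
proof -
  have k: "transpose k ** sympl_J ** k = sympl_J" using assms by (simp add: Sp_C_def)
  have "(- (sympl_J ** transpose k ** sympl_J)) ** k = - (sympl_J ** (transpose k ** sympl_J ** k))"
    by (simp add: matrix_mul_assoc)
  also have "\<dots> = mat 1" by (simp only: k sympl_J_square minus_minus)
  finally show *: "k ** (- (sympl_J ** transpose k ** sympl_J)) = mat 1"
    by (rule matrix_left_right_inverse1)
  show "matrix_inv k = - (sympl_J ** transpose k ** sympl_J)"
    by (rule matrix_inv_unique[OF *])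
qed

lemma pow_dim_act_Sp:
  assumes "g \<in> Sp_C \<times> Sp_C"
  shows "pow_dim (assoc_Sp (act g y)) k e = pow_dim (assoc_Sp y) k e"
proof -
  obtain k1 k2 where g: "g = (k1, k2)" by (cases g)
  have k: "k1 \<in> Sp_C" "k2 \<in> Sp_C" using assms by (simp_all add: g)
  have k1: "transpose k1 ** sympl_J ** k1 = sympl_J" using k(1) by (simp add: Sp_C_def)
  note inv = Sp_C_inverse[OF k(2)]
  have inv': "matrix_inv k2 ** k2 = mat 1"
    unfolding inv(2) by (rule matrix_left_right_inverse1[OF inv(1)])
  \<comment> \<open>The lower block is treated after multiplication by \<open>k1\<close> on the
    right, where the defining relation of the symplectic group for \<open>k1\<close> applies
    directly.\<close>
  have "sympl_J ** (transpose (k1 ** y ** matrix_inv k2)) ** sympl_J ** k1 =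
      sympl_J ** transpose (matrix_inv k2) ** transpose y ** (transpose k1 ** sympl_J ** k1)"
    by (simp add: matrix_transpose_mul matrix_mul_assoc)
  also have "sympl_J ** transpose (matrix_inv k2) = k2 ** sympl_J"
    unfolding inv(2)
    by (simp add: transpose_uminus matrix_transpose_mul transpose_sympl_J sympl_J_square matrix_mul_assoc)
  finally show ?thesis unfolding g act_def assoc_Sp_def prod.case
    by (intro pow_dim_conj_blocks[where ?g1.0 = k1 and ?g2.0 = k2, OF _ _ Sp_C_inverse(1)[OF k(1)] Sp_C_inverse(1)[OF k(2)]])
      (simp_all add: inv' k1 matrix_mul_cancel matrix_mul_assoc flip: matrix_mul_assoc[of _ _ k2])
qed

section \<open>The three dual pairs\<close>

text \<open>The columns of \<open>M\<close> are distinct coordinate vectors. As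
  \<open>transpose\<close> involves no conjugation, \<open>M\<close> preserves the bilinear form
  that enters the moment maps.\<close>

lemma ex_isometric_embedding:
  assumes "CARD('b) \<le> CARD('a)"
  shows "\<exists>M :: ('a::finite, 'b::finite) cmat. transpose M ** M = mat 1"
proof -
  obtain f :: "'b \<Rightarrow> 'a" where f: "inj f"
    using card_le_inj[of "UNIV :: 'b set" "UNIV :: 'a set"] assms by auto
  let ?M = "(\<chi> i j. if i = f j then 1 else 0) :: ('a, 'b) cmat"
  have "(transpose ?M ** ?M) $ i $ j = (\<Sum>k\<in>UNIV. if k = f i then if i = j then 1 else 0 else 0)" for i j
    unfolding matrix_matrix_mult_def transpose_def vec_lambda_beta
    by (intro sum.cong) (auto simp: inj_eq[OF f])
  then have "transpose ?M ** ?M = mat 1" by (simp add: vec_eq_iff mat_def)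
  then show ?thesis by blast
qed

lemma matrix_mult_distribs:
  fixes A B :: "'a::ring_1^'n^'m"
  shows "(A + B) ** C = A ** C + B ** C" "(A - B) ** C = A ** C - B ** C"
    "M ** (A + B) = M ** A + M ** B" "M ** (A - B) = M ** A - M ** B"
  by (simp_all add: vec_eq_iff matrix_matrix_mult_def algebra_simps sum.distrib sum_subtractf)

definition stack :: "('a, 'c) cmat \<Rightarrow> ('b, 'c) cmat \<Rightarrow> ('a::finite + 'b::finite, 'c::finite) cmat"
  where "stack U V = (\<chi> i j. case i of Inl a \<Rightarrow> U $ a $ j | Inr b \<Rightarrow> V $ b $ j)"

lemma transpose_stack_mult: "transpose (stack P Q) ** stack U V = transpose P ** U + transpose Q ** V"
  by (simp add: vec_eq_iff matrix_matrix_mult_def transpose_def stack_def sum_UNIV_Plus)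

lemma four_block_mult_stack: "four_block A B C D ** stack U V = stack (A ** U + B ** V) (C ** U + D ** V)"
  by (simp add: vec_eq_iff matrix_matrix_mult_def four_block_def stack_def sum_UNIV_Plus split_sum_all)

text \<open>For \<open>U = (1 + X) / 2\<close>, \<open>V = (1 - X) / 2\<i>\<close> one has \<open>U\<^sup>2 + V\<^sup>2 = X\<close> and
  \<open>U + \<i> V = 1\<close>.\<close>

lemma ex_symmetric_gram:
  fixes X :: "('n::finite, 'n) cmat"
  assumes "2 * CARD('n) \<le> CARD('p)" "transpose X = X"
  shows "\<exists>(A :: ('p::finite, 'n) cmat) L. transpose A ** A = X \<and> L ** A = mat 1"
proof -
  \<comment> \<open>The stable range provides room for two square blocks on top of each
    other.\<close>
  obtain M :: "('p, 'n + 'n) cmat" where M: "transpose M ** M = mat 1"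
    using ex_isometric_embedding[where 'a = 'p and 'b = "'n + 'n"] assms(1) by (auto simp: mult_2)
  define U where "U = cscale (1 / 2) (mat 1 + X)"
  define V where "V = cscale (- \<i> / 2) (mat 1 - X)"
  have t: "transpose U = U" "transpose V = V"
    by (simp_all add: U_def V_def transpose_add transpose_diff assms(2))
  have "U ** U + V ** V = cscale (1 / 4) ((mat 1 + X) ** (mat 1 + X) - (mat 1 - X) ** (mat 1 - X))"
    by (simp add: U_def V_def) (simp add: cscale_def vec_eq_iff diff_divide_distrib)
  also have "(mat 1 + X) ** (mat 1 + X) - (mat 1 - X) ** (mat 1 - X) = cscale 4 X"
    by (simp add: matrix_mult_distribs)
      (simp add: cscale_def vec_eq_iff)
  finally have UV: "U ** U + V ** V = X" by simp
  have UV': "U + cscale \<i> V = mat 1"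
    by (simp add: U_def V_def) (simp add: cscale_def vec_eq_iff field_simps)
  let ?A = "M ** stack U V" and ?L = "transpose (stack (mat 1) (cscale \<i> (mat 1))) ** transpose M"
  have "transpose ?A ** ?A = transpose (stack U V) ** (transpose M ** M) ** stack U V"
    by (simp add: matrix_transpose_mul matrix_mul_assoc)
  also have "\<dots> = X" by (simp add: M transpose_stack_mult t UV)
  finally have "transpose ?A ** ?A = X" .
  moreover have "?L ** ?A = transpose (stack (mat 1) (cscale \<i> (mat 1))) ** (transpose M ** M) ** stack U V"
    by (simp add: matrix_mul_assoc)
  then have "?L ** ?A = mat 1" by (simp add: M transpose_stack_mult UV')
  ultimately show ?thesis by blast
qed

text \<open>For blocks \<open>M\<close> and \<open>M X / 2\<close> the symplectic Gram matrix is
  half the difference of \<open>X\<close> and its transpose, which is \<open>X\<close>. The upper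
  block \<open>M\<close> already makes \<open>A\<close> injective.\<close>

lemma ex_alternating_gram:
  fixes X :: "('n::finite, 'n) cmat"
  assumes "CARD('n) \<le> CARD('p)" "transpose X = - X"
  shows "\<exists>(A :: ('p::finite + 'p, 'n) cmat) L. transpose A ** sympl_J ** A = X \<and> L ** A = mat 1"
proof -
  obtain M :: "('p, 'n) cmat" where M: "transpose M ** M = mat 1"
    using ex_isometric_embedding[where 'a = 'p and 'b = 'n] assms(1) by auto
  let ?N = "cscale (1 / 2) (M ** X)"
  let ?A = "stack M ?N" and ?L = "transpose (stack M 0)"
  have "transpose ?A ** sympl_J ** ?A = transpose ?A ** (sympl_J ** ?A)"
    by (simp add: matrix_mul_assoc)
  also have "\<dots> = cscale (1 / 2) (transpose M ** M ** X - transpose X ** (transpose M ** M))"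
    by (simp add: sympl_J_def four_block_mult_stack transpose_stack_mult matrix_transpose_mul
        matrix_mul_assoc cscale_diff)
  also have "\<dots> = X"
    by (simp add: M assms(2)) (simp add: cscale_def vec_eq_iff)
  finally have "transpose ?A ** sympl_J ** ?A = X" .
  moreover have "?L ** ?A = mat 1" by (simp add: transpose_stack_mult M)
  ultimately show ?thesis by blast
qed

text \<open>In the orthogonal sum of two coordinate spaces, \<open>A\<close> spans the first one,
  and \<open>B\<close> is the graph of \<open>X\<close> over the second one. The projection to the
  second summand inverts \<open>B\<close> on the left.\<close>

lemma ex_gram:
  fixes X :: "('m::finite, 'n::finite) cmat"
  assumes "CARD('m) + CARD('n) \<le> CARD('p)"
  shows "\<exists>(A :: ('p::finite, 'm) cmat) (B :: ('p, 'n) cmat) L1 L2.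
    transpose A ** B = X \<and> L1 ** A = mat 1 \<and> L2 ** B = mat 1"
proof -
  obtain M :: "('p, 'm + 'n) cmat" where M: "transpose M ** M = mat 1"
    using ex_isometric_embedding[where 'a = 'p and 'b = "'m + 'n"] assms(1) by auto
  have mult: "transpose (M ** P) ** (M ** Q) = transpose P ** Q" for P :: "('m + 'n, 'a::finite) cmat"
    and Q :: "('m + 'n, 'b::finite) cmat"
  proof -
    have "transpose (M ** P) ** (M ** Q) = transpose P ** (transpose M ** M) ** Q"
      by (simp add: matrix_transpose_mul matrix_mul_assoc)
    then show ?thesis by (simp add: M)
  qed
  let ?A = "stack (mat 1) 0 :: ('m + 'n, 'm) cmat" and ?B = "stack X (mat 1) :: ('m + 'n, 'n) cmat"
  let ?L = "stack 0 (mat 1) :: ('m + 'n, 'n) cmat"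
  have "transpose (M ** ?A) ** (M ** ?B) = X" "transpose (M ** ?A) ** (M ** ?A) = mat 1"
    "transpose (M ** ?L) ** (M ** ?B) = mat 1"
    unfolding mult by (simp_all add: transpose_stack_mult)
  then show ?thesis by blast
qed

section \<open>The moment maps of the three pairs as factorizations\<close>

lemma transpose_left_inverse:
  fixes L :: "'a::comm_semiring_1^'n^'m"
  shows "L ** A = mat 1 \<Longrightarrow> transpose A ** transpose L = mat 1"
  by (metis matrix_transpose_mul transpose_mat)

text \<open>The minus sign in the lower block of \<open>assoc_O\<close> is shared between
  \<open>cscale \<i> B\<close> and \<open>cscale \<i> (transpose A)\<close>, so that both products
  \<open>S1 ** T2\<close> and \<open>S2 ** T1\<close> acquire the same scalar \<i>.\<close>

lemma pow_dim_phi_O: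
  shows "pow_dim (assoc_O (phi_O w)) (Suc k) e \<le> pow_dim (assoc' (psi_O w)) k ((flip_sign ^^ Suc k) e)"
    and "L1 ** fst w = mat 1 \<Longrightarrow> L2 ** snd w = mat 1 \<Longrightarrow>
      pow_dim (assoc_O (phi_O w)) (Suc k) e = pow_dim (assoc' (psi_O w)) k ((flip_sign ^^ Suc k) e)"
proof -
  obtain A B where w: "w = (A, B)" by (cases w)
  have z: "assoc_O (A ** transpose B) = four_block 0 (A ** transpose B) (cscale \<i> B ** cscale \<i> (transpose A)) 0"
    by (simp add: assoc_O_def matrix_transpose_mul)
  have ST: "transpose B ** cscale \<i> B = cscale \<i> (transpose (transpose B ** B))"
    "cscale \<i> (transpose A) ** A = cscale \<i> (transpose (transpose A ** A))"
    by (simp_all add: matrix_transpose_mul)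
  note lift = pow_dim_lift_blocks[OF z ST]
  show "pow_dim (assoc_O (phi_O w)) (Suc k) e \<le> pow_dim (assoc' (psi_O w)) k ((flip_sign ^^ Suc k) e)"
    using lift(1) by (simp add: w phi_O_def psi_O_def del: funpow.simps)
  assume L: "L1 ** fst w = mat 1" "L2 ** snd w = mat 1"
  have "L1 ** A = mat 1" "cscale (- \<i>) L2 ** cscale \<i> B = mat 1" "transpose B ** transpose L2 = mat 1"
    "cscale \<i> (transpose A) ** cscale (- \<i>) (transpose L1) = mat 1"
    using L by (simp_all add: w transpose_left_inverse)
  from lift(2)[OF _ this]
  show "pow_dim (assoc_O (phi_O w)) (Suc k) e = pow_dim (assoc' (psi_O w)) k ((flip_sign ^^ Suc k) e)"
    by (simp add: w phi_O_def psi_O_def del: funpow.simps)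
qed

lemma pow_dim_phi_U:
  shows "pow_dim (assoc_U (phi_U w)) (Suc k) e \<le> pow_dim (assoc' (psi_U w)) k ((flip_sign ^^ Suc k) e)"
    and "w = ((A, B), (C, D)) \<Longrightarrow> L1 ** A = mat 1 \<Longrightarrow> L2 ** B = mat 1 \<Longrightarrow> L3 ** C = mat 1 \<Longrightarrow> L4 ** D = mat 1 \<Longrightarrow>
      pow_dim (assoc_U (phi_U w)) (Suc k) e = pow_dim (assoc' (psi_U w)) k ((flip_sign ^^ Suc k) e)"
proof -
  have z: "assoc_U (A ** transpose C, D ** transpose B) = four_block 0 (A ** transpose C) (D ** transpose B) 0"
    for A :: "('a, 'c) cmat" and B :: "('a, 'd) cmat" and C :: "('b, 'c) cmat" and D :: "('b, 'd) cmat"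
    by (simp add: assoc_U_def)
  have ST: "transpose C ** D = cscale 1 (transpose (transpose D ** C))"
    "transpose B ** A = cscale 1 (transpose (transpose A ** B))"
    for A :: "('a, 'c) cmat" and B :: "('a, 'd) cmat" and C :: "('b, 'c) cmat" and D :: "('b, 'd) cmat"
    by (simp_all add: matrix_transpose_mul)
  note lift = pow_dim_lift_blocks[OF z ST one_neq_zero]
  obtain A' B' C' D' where w: "w = ((A', B'), (C', D'))" by (metis surj_pair)
  show "pow_dim (assoc_U (phi_U w)) (Suc k) e \<le> pow_dim (assoc' (psi_U w)) k ((flip_sign ^^ Suc k) e)"
    using lift(1) by (simp add: w phi_U_def psi_U_def del: funpow.simps)
  assume w: "w = ((A, B), (C, D))"
    and L: "L1 ** A = mat 1" "L2 ** B = mat 1" "L3 ** C = mat 1" "L4 ** D = mat 1"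
  from lift(2)[OF L(1,4) transpose_left_inverse[OF L(3)] transpose_left_inverse[OF L(2)]]
  show "pow_dim (assoc_U (phi_U w)) (Suc k) e = pow_dim (assoc' (psi_U w)) k ((flip_sign ^^ Suc k) e)"
    by (simp add: w phi_U_def psi_U_def del: funpow.simps)
qed

text \<open>The two factors \<open>sympl_J\<close> of the lower block go to \<open>B\<close> and to
  \<open>transpose A\<close>. The scalar is -1, because the symplectic Gram matrices are
  alternating.\<close>

lemma pow_dim_phi_Sp:
  shows "pow_dim (assoc_Sp (phi_Sp w)) (Suc k) e \<le> pow_dim (assoc' (psi_Sp w)) k ((flip_sign ^^ Suc k) e)"
    and "L1 ** fst w = mat 1 \<Longrightarrow> L2 ** snd w = mat 1 \<Longrightarrow>
      pow_dim (assoc_Sp (phi_Sp w)) (Suc k) e = pow_dim (assoc' (psi_Sp w)) k ((flip_sign ^^ Suc k) e)"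
proof -
  obtain A B where w: "w = (A, B)" by (cases w)
  have z: "assoc_Sp (A ** transpose B) =
      four_block 0 (A ** transpose B) ((sympl_J ** B) ** (transpose A ** sympl_J)) 0"
    by (simp add: assoc_Sp_def matrix_transpose_mul matrix_mul_assoc)
  have ST: "transpose B ** (sympl_J ** B) = cscale (-1) (transpose (transpose B ** sympl_J ** B))"
    "(transpose A ** sympl_J) ** A = cscale (-1) (transpose (transpose A ** sympl_J ** A))"
    by (simp_all add: matrix_transpose_mul transpose_sympl_J matrix_mul_assoc)
  have c: "(-1 :: complex) \<noteq> 0" by simp
  note lift = pow_dim_lift_blocks[OF z ST c]
  show "pow_dim (assoc_Sp (phi_Sp w)) (Suc k) e \<le> pow_dim (assoc' (psi_Sp w)) k ((flip_sign ^^ Suc k) e)"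
    using lift(1) by (simp add: w phi_Sp_def psi_Sp_def del: funpow.simps)
  assume L: "L1 ** fst w = mat 1" "L2 ** snd w = mat 1"
  have JJ: "(- sympl_J) ** sympl_J = mat 1" "sympl_J ** (- sympl_J) = mat 1"
    by (simp_all add: sympl_J_square)
  have "(L2 ** (- sympl_J)) ** (sympl_J ** B) = L2 ** ((- sympl_J) ** sympl_J) ** B"
    by (simp only: matrix_mul_assoc)
  then have L2: "(L2 ** (- sympl_J)) ** (sympl_J ** B) = mat 1"
    using L(2) by (simp only: JJ matrix_mul_rid w snd_conv)
  have "(transpose A ** sympl_J) ** ((- sympl_J) ** transpose L1) = transpose A ** (sympl_J ** (- sympl_J)) ** transpose L1"
    by (simp only: matrix_mul_assoc)
  then have R2: "(transpose A ** sympl_J) ** ((- sympl_J) ** transpose L1) = mat 1"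
    using transpose_left_inverse[OF L(1)] by (simp only: JJ matrix_mul_rid w fst_conv)
  have "L1 ** A = mat 1" "transpose B ** transpose L2 = mat 1"
    using L by (simp_all add: w transpose_left_inverse)
  from lift(2)[OF this(1) L2 this(2) R2]
  show "pow_dim (assoc_Sp (phi_Sp w)) (Suc k) e = pow_dim (assoc' (psi_Sp w)) k ((flip_sign ^^ Suc k) e)"
    by (simp add: w phi_Sp_def psi_Sp_def del: funpow.simps)
qed

section \<open>Orbits and the diagrams of their lifts\<close>

lemma nilpotent_orbitE:
  assumes "nilpotent_orbit K a \<s> f \<O>"
  obtains x where "x \<in> \<s>" "\<O> = {a g x | g. g \<in> K}"
  using assms by (auto simp: nilpotent_orbit_def)

lemma nilpotent_orbit_imp_orbit:
  assumes "nilpotent_orbit K a \<s> f \<O>"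
  shows "\<exists>x. \<O> = {a g x | g. g \<in> K}"
  using nilpotent_orbitE[OF assms] by metis

lemma in_orbitI: "g \<in> K \<Longrightarrow> a g x \<in> {a g x | g. g \<in> K}"
  by blast

lemma mat_1_in_groups: "mat 1 \<in> GL" "mat 1 \<in> O_C" "mat 1 \<in> Sp_C"
  by (auto simp: GL_def O_C_def Sp_C_def orthogonal_matrix_def invertible_def
      intro!: exI[of _ "mat 1"])

lemma matrix_inv_mat_1: "matrix_inv (mat 1) = (mat 1 :: 'a::field^'n^'n)"
  by (rule matrix_inv_unique) simp

lemma act'_mat_1: "act' (mat 1) x = x"
  by (cases x) (simp add: act'_def matrix_inv_mat_1)

lemma act_U_mat_1: "act_U (mat 1, mat 1) x = x"
  by (cases x) (simp add: act_U_def matrix_inv_mat_1)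

lemma continuous_on_assoc:
  "continuous_on UNIV assoc'" "continuous_on UNIV assoc_O" "continuous_on UNIV assoc_Sp"
  unfolding assoc'_def assoc_O_def assoc_Sp_def case_prod_beta'
  by (intro continuous_intros continuous_on_id)+

lemma graded_assoc:
  "graded flip_sign (assoc' x)" "graded flip_sign (assoc_O y)" "graded flip_sign (assoc_Sp w)"
  by (cases x) (simp_all add: assoc'_def assoc_O_def assoc_Sp_def graded_four_block)

lemma signed_young_rewrite_rows: "signed_young_diagram D \<Longrightarrow> [] \<notin># rewrite_rows P D"
  by (auto simp: signed_young_diagram_def rewrite_rows_def)

lemma theta_lift_diagram_O:
  fixes \<O>' :: "(('n::finite, 'n) cmat \<times> ('n, 'n) cmat) set" and \<O> :: "('p::finite, 'q::finite) cmat set"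
  assumes card: "2 * CARD('n) \<le> CARD('p)" "2 * CARD('n) \<le> CARD('q)"
    and orb: "nilp_orbit_O' \<O>'" "nilp_orbit_O \<O>"
    and \<theta>: "theta_lift phi_O (psi_O :: ('p, 'n) cmat \<times> ('q, 'n) cmat \<Rightarrow> _) \<O>' \<O>"
    and \<Lambda>': "orbit_diagram_O' \<O>' \<Lambda>'"
  shows "[] \<notin># \<Lambda>'" "O_diagram CARD('p) CARD('q) (lift_diagram CARD('p) CARD('q) \<Lambda>')"
    "orbit_diagram_O \<O> (lift_diagram CARD('p) CARD('q) \<Lambda>')"
proof -
  obtain x where x: "x \<in> {(X, Y). transpose X = X \<and> transpose Y = Y}" "\<O>' = {act' g x | g. g \<in> GL}"
    using nilpotent_orbitE[OF orb(1)[unfolded nilp_orbit_O'_def]] .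
  obtain X Y where XY: "x = (X, Y)" "transpose X = X" "transpose Y = Y" using x(1) by auto
  have "act' (mat 1) x \<in> \<O>'" unfolding x(2) by (intro in_orbitI mat_1_in_groups)
  then have x\<O>: "x \<in> \<O>'" by (simp only: act'_mat_1)
  obtain z\<^sub>0 where z\<^sub>0: "\<O> = {act g z\<^sub>0 | g. g \<in> O_C \<times> O_C}"
    using nilpotent_orbit_imp_orbit[OF orb(2)[unfolded nilp_orbit_O_def]] by (elim exE)
  obtain D where D: "full_diagram' (assoc' x) D" "\<Lambda>' = rewrite_rows odd D"
    using \<Lambda>' x\<O> unfolding orbit_diagram_O'_def by blast
  obtain A :: "('p, 'n) cmat" and L1 where A: "transpose A ** A = X" "L1 ** A = mat 1"
    using ex_symmetric_gram[OF card(1) XY(2)] by blast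
  obtain B :: "('q, 'n) cmat" and L2 where B: "transpose B ** B = Y" "L2 ** B = mat 1"
    using ex_symmetric_gram[OF card(2) XY(3)] by blast
  have w: "psi_O (A, B) = x" by (simp add: psi_O_def A B XY)
  have lift: "pow_dim (assoc_O z) (Suc k) e = pow_dim (assoc' x) k ((flip_sign ^^ Suc k) e)"
    if z: "z \<in> \<O>" for z k e
  proof (rule theta_lift_pow_dim[OF \<theta> continuous_on_assoc(2,1) _ _ _ w _ x\<O> z])
    show "pow_dim (assoc_O y) k e = pow_dim (assoc_O z) k e" if "y \<in> \<O>" for y k e
      using that z by (auto simp: z\<^sub>0 pow_dim_act_O)
    show "pow_dim (assoc' y) k e = pow_dim (assoc' x) k e" if "y \<in> \<O>'" for y k e
      using that by (auto simp: x(2) pow_dim_act')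
    show "pow_dim (assoc_O (phi_O (A, B))) (Suc k) e = pow_dim (assoc' x) k ((flip_sign ^^ Suc k) e)" for k e
      using pow_dim_phi_O(2)[of L1 "(A, B)" L2 k e] by (simp only: A B w fst_conv snd_conv)
  qed (rule pow_dim_phi_O(1))
  let ?p = "CARD('p)" and ?q = "CARD('q)"
  have full: "full_diagram (assoc_O z) (lift_diagram ?p ?q D)" "signature (lift_diagram ?p ?q D) = (?p, ?q)"
    "signed_young_diagram D" if z: "z \<in> \<O>" for z
    by (rule full_diagram_lift[OF graded_assoc(2,1) D(1) lift[OF z]])+
  \<comment> \<open>One point of \<O> suffices for the facts about \<open>D\<close>, which do not
    mention \<open>z\<close>.\<close>
  have "act (mat 1, mat 1) z\<^sub>0 \<in> \<O>"
    unfolding z\<^sub>0 by (intro in_orbitI SigmaI mat_1_in_groups)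
  note fullD = full(2,3)[OF this]
  have sym: "count D (alternating Pos n) = count D (alternating Neg n)" if "odd n" for n
  proof (rule full_diagram'_symmetric[OF graded_assoc(1) D(1) _ that])
    show "pow_dim (assoc' x) j Pos = pow_dim (assoc' x) j Neg" if "even j" for j
      unfolding XY(1) by (rule pow_dim_symmetric[where s = 1]) (simp_all add: XY that)
  qed
  show "[] \<notin># \<Lambda>'" by (simp add: D(2) signed_young_rewrite_rows[OF fullD(2)])
  show "O_diagram ?p ?q (lift_diagram ?p ?q \<Lambda>')"
    unfolding D(2) by (rule O_diagram_lift[OF fullD(2,1) sym])
  show "orbit_diagram_O \<O> (lift_diagram ?p ?q \<Lambda>')"
    unfolding orbit_diagram_O_def D(2) using full(1) rewrite_rows_lift_diagram[OF fullD(2)] by metis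
qed

lemma theta_lift_diagram_U:
  fixes \<O>' :: "(('m::finite, 'n::finite) cmat \<times> ('n, 'm) cmat) set"
    and \<O> :: "(('p::finite, 'q::finite) cmat \<times> ('q, 'p) cmat) set"
  assumes card: "CARD('m) + CARD('n) \<le> CARD('p)" "CARD('m) + CARD('n) \<le> CARD('q)"
    and orb: "nilp_orbit_U' \<O>'" "nilp_orbit_U \<O>"
    and \<theta>: "theta_lift phi_U psi_U \<O>' \<O>"
    and \<Lambda>': "orbit_diagram_U' \<O>' \<Lambda>'"
  shows "[] \<notin># \<Lambda>'" "U_diagram CARD('p) CARD('q) (lift_diagram CARD('p) CARD('q) \<Lambda>')"
    "orbit_diagram_U \<O> (lift_diagram CARD('p) CARD('q) \<Lambda>')"
proof -
  obtain x where x: "\<O>' = {act_U g x | g. g \<in> GL \<times> GL}"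
    using nilpotent_orbit_imp_orbit[OF orb(1)[unfolded nilp_orbit_U'_def]] by (elim exE)
  obtain X Y where XY: "x = (X, Y)" by (cases x)
  have "act_U (mat 1, mat 1) x \<in> \<O>'" unfolding x by (intro in_orbitI SigmaI mat_1_in_groups)
  then have x\<O>: "x \<in> \<O>'" by (simp only: act_U_mat_1)
  obtain z\<^sub>0 where z\<^sub>0: "\<O> = {act_U g z\<^sub>0 | g. g \<in> GL \<times> GL}"
    using nilpotent_orbit_imp_orbit[OF orb(2)[unfolded nilp_orbit_U_def]] by (elim exE)
  have D: "full_diagram' (assoc' x) \<Lambda>'"
    using \<Lambda>' x\<O> unfolding orbit_diagram_U'_def by blast
  obtain A :: "('p, 'm) cmat" and B :: "('p, 'n) cmat" and L1 L2 where AB: "transpose A ** B = X"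
    "L1 ** A = mat 1" "L2 ** B = mat 1"
    using ex_gram[OF card(1)] by blast
  \<comment> \<open>The second component of \<open>psi_U\<close> pairs \<open>D\<close> with
    \<open>C\<close> in this order, so the roles of \<open>m\<close> and \<open>n\<close> are
    exchanged.\<close>
  obtain D' :: "('q, 'n) cmat" and C :: "('q, 'm) cmat" and L3 L4 where CD: "transpose D' ** C = Y"
    "L4 ** D' = mat 1" "L3 ** C = mat 1"
    using ex_gram[where X = Y and 'p = 'q] card(2) by (auto simp: add.commute)
  have w: "psi_U ((A, B), (C, D')) = x" by (simp add: psi_U_def AB CD XY)
  have lift: "pow_dim (assoc_U z) (Suc k) e = pow_dim (assoc' x) k ((flip_sign ^^ Suc k) e)"
    if z: "z \<in> \<O>" for z k e
  proof (rule theta_lift_pow_dim[OF \<theta> _ continuous_on_assoc(1) _ _ _ w _ x\<O> z])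
    show "continuous_on UNIV (assoc_U :: ('p, 'q) cmat \<times> ('q, 'p) cmat \<Rightarrow> _)"
      unfolding assoc_U_eq by (rule continuous_on_assoc(1))
    show "pow_dim (assoc_U y) k e = pow_dim (assoc_U z) k e" if "y \<in> \<O>" for y k e
      using that z by (auto simp: z\<^sub>0 pow_dim_act_U assoc_U_eq)
    show "pow_dim (assoc' y) k e = pow_dim (assoc' x) k e" if "y \<in> \<O>'" for y k e
      using that by (auto simp: x pow_dim_act_U)
    show "pow_dim (assoc_U (phi_U ((A, B), (C, D')))) (Suc k) e = pow_dim (assoc' x) k ((flip_sign ^^ Suc k) e)" for k e
      using pow_dim_phi_U(2)[OF refl AB(2,3) CD(3,2), of k e] by (simp only: w)
  qed (rule pow_dim_phi_U(1))
  let ?p = "CARD('p)" and ?q = "CARD('q)"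
  have gr: "graded flip_sign (assoc_U z)" for z :: "('p, 'q) cmat \<times> ('q, 'p) cmat"
    unfolding assoc_U_eq by (rule graded_assoc(1))
  have full: "full_diagram (assoc_U z) (lift_diagram ?p ?q \<Lambda>')" "signature (lift_diagram ?p ?q \<Lambda>') = (?p, ?q)"
    "signed_young_diagram \<Lambda>'" if z: "z \<in> \<O>" for z
    by (rule full_diagram_lift[OF gr graded_assoc(1) D lift[OF z]])+
  have "act_U (mat 1, mat 1) z\<^sub>0 \<in> \<O>"
    unfolding z\<^sub>0 by (intro in_orbitI SigmaI mat_1_in_groups)
  note fullD = full(2,3)[OF this]
  show "[] \<notin># \<Lambda>'" using fullD(2) by (auto simp: signed_young_diagram_def)
  show "U_diagram ?p ?q (lift_diagram ?p ?q \<Lambda>')"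
    using fullD(1) signed_young_lift_diagram[OF fullD(2)] by (simp add: U_diagram_def)
  show "orbit_diagram_U \<O> (lift_diagram ?p ?q \<Lambda>')"
    using full(1) by (simp add: orbit_diagram_U_def)
qed

lemma theta_lift_diagram_Sp:
  fixes \<O>' :: "(('n::finite, 'n) cmat \<times> ('n, 'n) cmat) set"
    and \<O> :: "('p::finite + 'p, 'q::finite + 'q) cmat set"
  assumes card: "CARD('n) \<le> CARD('p)" "CARD('n) \<le> CARD('q)"
    and orb: "nilp_orbit_Sp' \<O>'" "nilp_orbit_Sp \<O>"
    and \<theta>: "theta_lift phi_Sp (psi_Sp :: ('p + 'p, 'n) cmat \<times> ('q + 'q, 'n) cmat \<Rightarrow> _) \<O>' \<O>"
    and \<Lambda>': "orbit_diagram_Sp' \<O>' \<Lambda>'"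
  shows "[] \<notin># \<Lambda>'" "Sp_diagram CARD('p) CARD('q) (lift_diagram CARD('p) CARD('q) \<Lambda>')"
    "orbit_diagram_Sp \<O> (lift_diagram CARD('p) CARD('q) \<Lambda>')"
proof -
  obtain x where x: "x \<in> {(X, Y). transpose X = - X \<and> transpose Y = - Y}" "\<O>' = {act' g x | g. g \<in> GL}"
    using nilpotent_orbitE[OF orb(1)[unfolded nilp_orbit_Sp'_def]] .
  obtain X Y where XY: "x = (X, Y)" "transpose X = - X" "transpose Y = - Y" using x(1) by auto
  have "act' (mat 1) x \<in> \<O>'" unfolding x(2) by (intro in_orbitI mat_1_in_groups)
  then have x\<O>: "x \<in> \<O>'" by (simp only: act'_mat_1)
  obtain z\<^sub>0 where z\<^sub>0: "\<O> = {act g z\<^sub>0 | g. g \<in> Sp_C \<times> Sp_C}"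
    using nilpotent_orbit_imp_orbit[OF orb(2)[unfolded nilp_orbit_Sp_def]] by (elim exE)
  obtain D where D: "full_diagram' (assoc' x) D" "halve_rows odd D \<Lambda>'"
    using \<Lambda>' x\<O> unfolding orbit_diagram_Sp'_def by blast
  obtain A :: "('p + 'p, 'n) cmat" and L1 where A: "transpose A ** sympl_J ** A = X" "L1 ** A = mat 1"
    using ex_alternating_gram[OF card(1) XY(2)] by blast
  obtain B :: "('q + 'q, 'n) cmat" and L2 where B: "transpose B ** sympl_J ** B = Y" "L2 ** B = mat 1"
    using ex_alternating_gram[OF card(2) XY(3)] by blast
  have w: "psi_Sp (A, B) = x" by (simp add: psi_Sp_def A B XY)
  have lift: "pow_dim (assoc_Sp z) (Suc k) e = pow_dim (assoc' x) k ((flip_sign ^^ Suc k) e)"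
    if z: "z \<in> \<O>" for z k e
  proof (rule theta_lift_pow_dim[OF \<theta> continuous_on_assoc(3,1) _ _ _ w _ x\<O> z])
    show "pow_dim (assoc_Sp y) k e = pow_dim (assoc_Sp z) k e" if "y \<in> \<O>" for y k e
      using that z by (auto simp: z\<^sub>0 pow_dim_act_Sp)
    show "pow_dim (assoc' y) k e = pow_dim (assoc' x) k e" if "y \<in> \<O>'" for y k e
      using that by (auto simp: x(2) pow_dim_act')
    show "pow_dim (assoc_Sp (phi_Sp (A, B))) (Suc k) e = pow_dim (assoc' x) k ((flip_sign ^^ Suc k) e)" for k e
      using pow_dim_phi_Sp(2)[of L1 "(A, B)" L2 k e] by (simp only: A B w fst_conv snd_conv)
  qed (rule pow_dim_phi_Sp(1))
  let ?p = "CARD('p)" and ?q = "CARD('q)"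
  \<comment> \<open>The spaces have dimensions \<open>2 * ?p\<close> and \<open>2 * ?q\<close>;
    halving the full diagram brings the signature back to \<open>(?p, ?q)\<close>.\<close>
  have full: "full_diagram (assoc_Sp z) (lift_diagram (2 * ?p) (2 * ?q) D)"
    "signature (lift_diagram (2 * ?p) (2 * ?q) D) = (2 * ?p, 2 * ?q)"
    "signed_young_diagram D" if z: "z \<in> \<O>" for z
    using full_diagram_lift[OF graded_assoc(3,1) D(1) lift[OF z]] by (simp_all add: mult_2)
  have "act (mat 1, mat 1) z\<^sub>0 \<in> \<O>"
    unfolding z\<^sub>0 by (intro in_orbitI SigmaI mat_1_in_groups)
  note fullD = full(2,3)[OF this]
  have sym: "count D (alternating Pos n) = count D (alternating Neg n)" if "odd n" for n
  proof (rule full_diagram'_symmetric[OF graded_assoc(1) D(1) _ that])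
    show "pow_dim (assoc' x) j Pos = pow_dim (assoc' x) j Neg" if "even j" for j
      unfolding XY(1) by (rule pow_dim_symmetric[where s = "-1"]) (simp_all add: XY that)
  qed
  note halve = lift_diagram_halve[OF fullD(2) D(2) sym fullD(1)]
  show "[] \<notin># \<Lambda>'" by (rule halve(3))
  show "Sp_diagram ?p ?q (lift_diagram ?p ?q \<Lambda>')" by (rule halve(2))
  show "orbit_diagram_Sp \<O> (lift_diagram ?p ?q \<Lambda>')"
    unfolding orbit_diagram_Sp_def using full(1) halve(1) by blast
qed

theorem proposition2p12:
  shows
    "(2 * CARD('n) < min CARD('p) CARD('q) \<longrightarrow>
       (\<forall>(\<O>' :: (('n, 'n::finite) cmat \<times> ('n, 'n) cmat) set)
         (\<O> :: ('p::finite, 'q::finite) cmat set) \<Lambda>'.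
         nilp_orbit_O' \<O>' \<and> nilp_orbit_O \<O> \<and>
         theta_lift phi_O (psi_O :: ('p, 'n) cmat \<times> ('q, 'n) cmat \<Rightarrow> _) \<O>' \<O> \<and>
         orbit_diagram_O' \<O>' \<Lambda>' \<longrightarrow>
         (\<exists>k \<Lambda>. add_boxes k \<Lambda>' \<Lambda> \<and> O_diagram CARD('p) CARD('q) \<Lambda> \<and> orbit_diagram_O \<O> \<Lambda> \<and>
           (\<forall>k\<^sub>2 \<Lambda>\<^sub>2. add_boxes k\<^sub>2 \<Lambda>' \<Lambda>\<^sub>2 \<and> O_diagram CARD('p) CARD('q) \<Lambda>\<^sub>2 \<longrightarrow>
             k\<^sub>2 = k \<and> \<Lambda>\<^sub>2 = \<Lambda>)))) \<and>
     (CARD('m) + CARD('n) \<le> min CARD('p) CARD('q) \<longrightarrow>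
       (\<forall>(\<O>' :: (('m::finite, 'n) cmat \<times> ('n, 'm) cmat) set)
         (\<O> :: (('p, 'q) cmat \<times> ('q, 'p) cmat) set) \<Lambda>'.
         nilp_orbit_U' \<O>' \<and> nilp_orbit_U \<O> \<and>
         theta_lift phi_U psi_U \<O>' \<O> \<and>
         orbit_diagram_U' \<O>' \<Lambda>' \<longrightarrow>
         (\<exists>k \<Lambda>. add_boxes k \<Lambda>' \<Lambda> \<and> U_diagram CARD('p) CARD('q) \<Lambda> \<and> orbit_diagram_U \<O> \<Lambda> \<and>
           (\<forall>k\<^sub>2 \<Lambda>\<^sub>2. add_boxes k\<^sub>2 \<Lambda>' \<Lambda>\<^sub>2 \<and> U_diagram CARD('p) CARD('q) \<Lambda>\<^sub>2 \<longrightarrow>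
             k\<^sub>2 = k \<and> \<Lambda>\<^sub>2 = \<Lambda>)))) \<and>
     (CARD('n) \<le> min CARD('p) CARD('q) \<longrightarrow>
       (\<forall>(\<O>' :: (('n, 'n) cmat \<times> ('n, 'n) cmat) set)
         (\<O> :: ('p + 'p, 'q + 'q) cmat set) \<Lambda>'.
         nilp_orbit_Sp' \<O>' \<and> nilp_orbit_Sp \<O> \<and>
         theta_lift phi_Sp (psi_Sp :: ('p + 'p, 'n) cmat \<times> ('q + 'q, 'n) cmat \<Rightarrow> _) \<O>' \<O> \<and>
         orbit_diagram_Sp' \<O>' \<Lambda>' \<longrightarrow>
         (\<exists>k \<Lambda>. add_boxes k \<Lambda>' \<Lambda> \<and> Sp_diagram CARD('p) CARD('q) \<Lambda> \<and> orbit_diagram_Sp \<O> \<Lambda> \<and>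
           (\<forall>k\<^sub>2 \<Lambda>\<^sub>2. add_boxes k\<^sub>2 \<Lambda>' \<Lambda>\<^sub>2 \<and> Sp_diagram CARD('p) CARD('q) \<Lambda>\<^sub>2 \<longrightarrow>
             k\<^sub>2 = k \<and> \<Lambda>\<^sub>2 = \<Lambda>))))"
proof (intro conjI impI allI; (elim conjE)?)
  fix \<O>' :: "(('n, 'n) cmat \<times> ('n, 'n) cmat) set" and \<O> :: "('p, 'q) cmat set" and \<Lambda>'
  assume "2 * CARD('n) < min CARD('p) CARD('q)"
    and "nilp_orbit_O' \<O>'" "nilp_orbit_O \<O>"
      "theta_lift phi_O (psi_O :: ('p, 'n) cmat \<times> ('q, 'n) cmat \<Rightarrow> _) \<O>' \<O>" "orbit_diagram_O' \<O>' \<Lambda>'"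
  then have L: "[] \<notin># \<Lambda>'" "O_diagram CARD('p) CARD('q) (lift_diagram CARD('p) CARD('q) \<Lambda>')"
    "orbit_diagram_O \<O> (lift_diagram CARD('p) CARD('q) \<Lambda>')"
    using theta_lift_diagram_O[of \<O>' \<O> \<Lambda>'] by simp_all
  show "\<exists>k \<Lambda>. add_boxes k \<Lambda>' \<Lambda> \<and> O_diagram CARD('p) CARD('q) \<Lambda> \<and> orbit_diagram_O \<O> \<Lambda> \<and>
      (\<forall>k\<^sub>2 \<Lambda>\<^sub>2. add_boxes k\<^sub>2 \<Lambda>' \<Lambda>\<^sub>2 \<and> O_diagram CARD('p) CARD('q) \<Lambda>\<^sub>2 \<longrightarrow> k\<^sub>2 = k \<and> \<Lambda>\<^sub>2 = \<Lambda>)"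
    using lift_diagram_add_boxes[OF L(1), of "CARD('p)" "CARD('q)"] L(2,3) unfolding O_diagram_def by blast
next
  fix \<O>' :: "(('m, 'n) cmat \<times> ('n, 'm) cmat) set" and \<O> :: "(('p, 'q) cmat \<times> ('q, 'p) cmat) set" and \<Lambda>'
  assume "CARD('m) + CARD('n) \<le> min CARD('p) CARD('q)"
    and "nilp_orbit_U' \<O>'" "nilp_orbit_U \<O>" "theta_lift phi_U psi_U \<O>' \<O>" "orbit_diagram_U' \<O>' \<Lambda>'"
  then have L: "[] \<notin># \<Lambda>'" "U_diagram CARD('p) CARD('q) (lift_diagram CARD('p) CARD('q) \<Lambda>')"
    "orbit_diagram_U \<O> (lift_diagram CARD('p) CARD('q) \<Lambda>')"
    using theta_lift_diagram_U[of \<O>' \<O> \<Lambda>'] by simp_all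
  show "\<exists>k \<Lambda>. add_boxes k \<Lambda>' \<Lambda> \<and> U_diagram CARD('p) CARD('q) \<Lambda> \<and> orbit_diagram_U \<O> \<Lambda> \<and>
      (\<forall>k\<^sub>2 \<Lambda>\<^sub>2. add_boxes k\<^sub>2 \<Lambda>' \<Lambda>\<^sub>2 \<and> U_diagram CARD('p) CARD('q) \<Lambda>\<^sub>2 \<longrightarrow> k\<^sub>2 = k \<and> \<Lambda>\<^sub>2 = \<Lambda>)"
    using lift_diagram_add_boxes[OF L(1), of "CARD('p)" "CARD('q)"] L(2,3) unfolding U_diagram_def by blast
next
  fix \<O>' :: "(('n, 'n) cmat \<times> ('n, 'n) cmat) set" and \<O> :: "('p + 'p, 'q + 'q) cmat set" and \<Lambda>'
  assume "CARD('n) \<le> min CARD('p) CARD('q)"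
    and "nilp_orbit_Sp' \<O>'" "nilp_orbit_Sp \<O>"
      "theta_lift phi_Sp (psi_Sp :: ('p + 'p, 'n) cmat \<times> ('q + 'q, 'n) cmat \<Rightarrow> _) \<O>' \<O>" "orbit_diagram_Sp' \<O>' \<Lambda>'"
  then have L: "[] \<notin># \<Lambda>'" "Sp_diagram CARD('p) CARD('q) (lift_diagram CARD('p) CARD('q) \<Lambda>')"
    "orbit_diagram_Sp \<O> (lift_diagram CARD('p) CARD('q) \<Lambda>')"
    using theta_lift_diagram_Sp[of \<O>' \<O> \<Lambda>'] by simp_all
  show "\<exists>k \<Lambda>. add_boxes k \<Lambda>' \<Lambda> \<and> Sp_diagram CARD('p) CARD('q) \<Lambda> \<and> orbit_diagram_Sp \<O> \<Lambda> \<and>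
      (\<forall>k\<^sub>2 \<Lambda>\<^sub>2. add_boxes k\<^sub>2 \<Lambda>' \<Lambda>\<^sub>2 \<and> Sp_diagram CARD('p) CARD('q) \<Lambda>\<^sub>2 \<longrightarrow> k\<^sub>2 = k \<and> \<Lambda>\<^sub>2 = \<Lambda>)"
    using lift_diagram_add_boxes[OF L(1), of "CARD('p)" "CARD('q)"] L(2,3) unfolding Sp_diagram_def by blast
qed

end
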